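(* Let $M$ be a connected real smooth manifold without boundary and let $(E,\nabla)$ be a non-zero real smooth finite-dimensional vector bundle on $M$ with a projectively flat connection. Then there is a 1-form $\omega\in\Omega^1(M)$ (real-valued) such that $\nabla':=\nabla-\omega$ is a flat connection on $E$. In particular, the curvature $h$ of $\nabla$ is equal to $d\omega$, i.e. $h$ is an exact 2-form.
   Context: A connection $\nabla$ on a real vector bundle $E$ is projectively flat if $\nabla^2=h\otimes\mathbb 1_E\in\Omega^2(M,\mathrm{End}(E))$ for some $h\in\Omega^2(M)$, which is called the curvature of $\nabla$; it is flat if $\nabla^2=0$. $\nabla-\omega$ means $\nabla-\omega\otimes\mathbb 1_E$. *)

theory Defs
  imports "HOL-Analysis.Analysis"
begin

text \<open>
  Throughout, the manifold is the whole type \<open>'m\<close>, a second countable Hausdorff space. The model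
  space \<open>'e\<close> of the charts and the model fibre \<open>'f\<close> of a vector bundle range over the real inner
  product spaces whose bounded closed sets are compact; these are exactly the spaces isometric to
  \<open>\<real>\<^sup>n\<close> for some \<open>n \<ge> 0\<close>. (The class \<open>euclidean_space\<close> would exclude \<open>n = 0\<close>.)
\<close>

section \<open>Smooth functions on open subsets of the model space\<close>

text \<open>For \<open>S\<close> open in a finite-dimensional space, \<open>C_diff k S f\<close> says that \<open>f\<close> is of class \<open>C^k\<close> on \<open>S\<close>.\<close>

fun C_diff :: "nat \<Rightarrow> 'a::real_normed_vector set \<Rightarrow> ('a \<Rightarrow> 'b::real_normed_vector) \<Rightarrow> bool"
  where
    "C_diff 0 S f \<longleftrightarrow> continuous_on S f"
  | "C_diff (Suc k) S f \<longleftrightarrow>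
       (\<forall>x\<in>S. f differentiable (at x)) \<and>
       (\<forall>v. C_diff k S (\<lambda>x. frechet_derivative f (at x) v))"

definition smooth_on :: "'a::real_normed_vector set \<Rightarrow> ('a \<Rightarrow> 'b::real_normed_vector) \<Rightarrow> bool"
  where "smooth_on S f \<longleftrightarrow> (\<forall>k. C_diff k S f)"


section \<open>Smooth manifolds\<close>

type_synonym ('m, 'e) chart = "'m set \<times> ('m \<Rightarrow> 'e)"

definition is_chart :: "('m::topological_space, 'e::topological_space) chart \<Rightarrow> bool"
  where "is_chart c \<longleftrightarrow> (case c of (U, \<phi>) \<Rightarrow>
    open U \<and> open (\<phi> ` U) \<and> homeomorphism U (\<phi> ` U) \<phi> (inv_into U \<phi>))"

text \<open>
  The atlas is not required to be maximal: it determines the smooth structure. Chart images are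
  open in the model space, so there is no boundary.
\<close>

definition smooth_atlas ::
  "('m::{t2_space, second_countable_topology}, 'e::{real_inner, heine_borel}) chart set \<Rightarrow> bool"
  where "smooth_atlas A \<longleftrightarrow>
    (\<forall>c\<in>A. is_chart c) \<and>
    (\<Union>(U, \<phi>)\<in>A. U) = UNIV \<and>
    (\<forall>(U, \<phi>)\<in>A. \<forall>(V, \<psi>)\<in>A. smooth_on (\<phi> ` (U \<inter> V)) (\<psi> \<circ> inv_into U \<phi>))"

definition smooth_fun_on ::
  "('m, 'e::real_normed_vector) chart set \<Rightarrow> 'm set \<Rightarrow> ('m \<Rightarrow> 'b::real_normed_vector) \<Rightarrow> bool"
  where "smooth_fun_on A W f \<longleftrightarrow>
    (\<forall>(U, \<phi>)\<in>A. smooth_on (\<phi> ` (U \<inter> W)) (f \<circ> inv_into U \<phi>))"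

definition smooth_funs :: "('m, 'e::real_normed_vector) chart set \<Rightarrow> ('m \<Rightarrow> real) set"
  where "smooth_funs A = {f. smooth_fun_on A UNIV f}"


section \<open>Tangent vectors, vector fields and differential forms\<close>

type_synonym 'm tangent = "('m \<Rightarrow> real) \<Rightarrow> real"

text \<open>
  Tangent vectors at \<open>p\<close> are the derivations at \<open>p\<close> of the algebra of smooth functions. Being HOL
  functions, they are also applied to functions that are not smooth; the value there is fixed to
  be \<open>0\<close>, so that a tangent vector is determined by its values on smooth functions.
\<close>

definition tangent_space :: "('m, 'e::real_normed_vector) chart set \<Rightarrow> 'm \<Rightarrow> 'm tangent set"
  where "tangent_space A p = {v.
    (\<forall>f\<in>smooth_funs A. \<forall>g\<in>smooth_funs A. v (\<lambda>q. f q + g q) = v f + v g) \<and>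
    (\<forall>c. \<forall>f\<in>smooth_funs A. v (\<lambda>q. c * f q) = c * v f) \<and>
    (\<forall>f\<in>smooth_funs A. \<forall>g\<in>smooth_funs A. v (\<lambda>q. f q * g q) = f p * v g + g p * v f) \<and>
    (\<forall>f. f \<notin> smooth_funs A \<longrightarrow> v f = 0)}"

definition vector_fields :: "('m, 'e::real_normed_vector) chart set \<Rightarrow> ('m \<Rightarrow> 'm tangent) set"
  where "vector_fields A = {X.
    (\<forall>p. X p \<in> tangent_space A p) \<and>
    (\<forall>f\<in>smooth_funs A. (\<lambda>p. X p f) \<in> smooth_funs A)}"

definition bracket :: "('m \<Rightarrow> 'm tangent) \<Rightarrow> ('m \<Rightarrow> 'm tangent) \<Rightarrow> 'm \<Rightarrow> 'm tangent"
  where "bracket X Y = (\<lambda>p f. X p (\<lambda>q. Y q f) - Y p (\<lambda>q. X q f))"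

definition linear_on_tangent ::
  "('m, 'e::real_normed_vector) chart set \<Rightarrow> 'm \<Rightarrow> ('m tangent \<Rightarrow> 'v::real_vector) \<Rightarrow> bool"
  where "linear_on_tangent A p \<alpha> \<longleftrightarrow>
    (\<forall>v\<in>tangent_space A p. \<forall>w\<in>tangent_space A p. \<alpha> (\<lambda>f. v f + w f) = \<alpha> v + \<alpha> w) \<and>
    (\<forall>c. \<forall>v\<in>tangent_space A p. \<alpha> (\<lambda>f. c * v f) = c *\<^sub>R \<alpha> v)"

definition one_form ::
  "('m, 'e::real_normed_vector) chart set \<Rightarrow> ('m \<Rightarrow> 'm tangent \<Rightarrow> real) \<Rightarrow> bool"
  where "one_form A \<omega> \<longleftrightarrow>
    (\<forall>p. linear_on_tangent A p (\<omega> p)) \<and>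
    (\<forall>X\<in>vector_fields A. (\<lambda>p. \<omega> p (X p)) \<in> smooth_funs A)"

definition two_form ::
  "('m, 'e::real_normed_vector) chart set \<Rightarrow> ('m \<Rightarrow> 'm tangent \<Rightarrow> 'm tangent \<Rightarrow> real) \<Rightarrow> bool"
  where "two_form A h \<longleftrightarrow>
    (\<forall>p. \<forall>v\<in>tangent_space A p.
       linear_on_tangent A p (\<lambda>w. h p v w) \<and>
       linear_on_tangent A p (\<lambda>w. h p w v) \<and>
       h p v v = 0) \<and>
    (\<forall>X\<in>vector_fields A. \<forall>Y\<in>vector_fields A. (\<lambda>p. h p (X p) (Y p)) \<in> smooth_funs A)"

text \<open>The function \<open>d\<omega>(X, Y) = X(\<omega>(Y)) - Y(\<omega>(X)) - \<omega>([X, Y])\<close>, for vector fields \<open>X\<close> and \<open>Y\<close>.\<close>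

definition ext_deriv ::
  "('m \<Rightarrow> 'm tangent \<Rightarrow> real) \<Rightarrow> ('m \<Rightarrow> 'm tangent) \<Rightarrow> ('m \<Rightarrow> 'm tangent) \<Rightarrow> 'm \<Rightarrow> real"
  where "ext_deriv \<omega> X Y p =
    X p (\<lambda>q. \<omega> q (Y q)) - Y p (\<lambda>q. \<omega> q (X q)) - \<omega> p (bracket X Y p)"

text \<open>
  \<open>h = d\<omega>\<close>. Every tangent vector is the value of some vector field, so comparing the two sides on
  vector fields determines \<open>h\<close> on all tangent spaces.
\<close>

definition is_ext_deriv ::
  "('m, 'e::real_normed_vector) chart set \<Rightarrow> ('m \<Rightarrow> 'm tangent \<Rightarrow> real)
    \<Rightarrow> ('m \<Rightarrow> 'm tangent \<Rightarrow> 'm tangent \<Rightarrow> real) \<Rightarrow> bool"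
  where "is_ext_deriv A \<omega> h \<longleftrightarrow>
    (\<forall>X\<in>vector_fields A. \<forall>Y\<in>vector_fields A. \<forall>p. h p (X p) (Y p) = ext_deriv \<omega> X Y p)"


section \<open>Vector bundles\<close>

text \<open>
  The fibre over \<open>p\<close> is a linear subspace \<open>E p\<close> of a real vector space \<open>'v\<close>, which carries no
  topology and only serves to hold all fibres (any family of vector spaces embeds into its direct
  sum). The bundle structure is given by an atlas \<open>T\<close> of local trivializations: a pair \<open>(U, \<tau>)\<close>
  consists of an open \<open>U\<close> and, for \<open>p\<close> in \<open>U\<close>, a linear isomorphism \<open>\<tau> p\<close> from the model fibre
  \<open>'f\<close> onto \<open>E p\<close>. The transition maps \<open>(\<sigma> p)\<inverse> \<circ> \<tau> p\<close> have to depend smoothly on \<open>p\<close>, which is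
  expressed on each vector of the model fibre.
\<close>

type_synonym ('m, 'v, 'f) trivialization = "'m set \<times> ('m \<Rightarrow> 'f \<Rightarrow> 'v)"

definition vector_bundle ::
  "('m::topological_space, 'e::real_normed_vector) chart set \<Rightarrow> ('m \<Rightarrow> 'v::real_vector set)
    \<Rightarrow> ('m, 'v, 'f::{real_inner, heine_borel}) trivialization set \<Rightarrow> bool"
  where "vector_bundle A E T \<longleftrightarrow>
    (\<forall>p. subspace (E p)) \<and>
    (\<Union>(U, \<tau>)\<in>T. U) = UNIV \<and>
    (\<forall>(U, \<tau>)\<in>T. open U \<and> (\<forall>p\<in>U. linear (\<tau> p) \<and> bij_betw (\<tau> p) UNIV (E p))) \<and>
    (\<forall>(U, \<tau>)\<in>T. \<forall>(V, \<sigma>)\<in>T. \<forall>x. smooth_fun_on A (U \<inter> V) (\<lambda>p. inv (\<sigma> p) (\<tau> p x)))"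

definition sections ::
  "('m, 'e::real_normed_vector) chart set \<Rightarrow> ('m \<Rightarrow> 'v set)
    \<Rightarrow> ('m, 'v, 'f::real_normed_vector) trivialization set \<Rightarrow> ('m \<Rightarrow> 'v) set"
  where "sections A E T = {s.
    (\<forall>p. s p \<in> E p) \<and>
    (\<forall>(U, \<tau>)\<in>T. smooth_fun_on A U (\<lambda>p. inv (\<tau> p) (s p)))}"

definition bundle_one_form ::
  "('m, 'e::real_normed_vector) chart set \<Rightarrow> ('m \<Rightarrow> 'v::real_vector set)
    \<Rightarrow> ('m, 'v, 'f::real_normed_vector) trivialization set \<Rightarrow> ('m \<Rightarrow> 'm tangent \<Rightarrow> 'v) \<Rightarrow> bool"
  where "bundle_one_form A E T \<alpha> \<longleftrightarrow>
    (\<forall>p. linear_on_tangent A p (\<alpha> p)) \<and>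
    (\<forall>p. \<forall>v\<in>tangent_space A p. \<alpha> p v \<in> E p) \<and>
    (\<forall>X\<in>vector_fields A. (\<lambda>p. \<alpha> p (X p)) \<in> sections A E T)"


section \<open>Connections\<close>

text \<open>A connection sends a section \<open>s\<close> to the \<open>E\<close>-valued 1-form \<open>\<nabla>s\<close>; \<open>nabla s p v\<close> is \<open>\<nabla>\<^sub>v s\<close> at \<open>p\<close>.\<close>

type_synonym ('m, 'v) conn = "('m \<Rightarrow> 'v) \<Rightarrow> 'm \<Rightarrow> 'm tangent \<Rightarrow> 'v"

definition connection ::
  "('m, 'e::real_normed_vector) chart set \<Rightarrow> ('m \<Rightarrow> 'v::real_vector set)
    \<Rightarrow> ('m, 'v, 'f::real_normed_vector) trivialization set \<Rightarrow> ('m, 'v) conn \<Rightarrow> bool"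
  where "connection A E T nabla \<longleftrightarrow>
    (\<forall>s\<in>sections A E T. bundle_one_form A E T (nabla s)) \<and>
    (\<forall>s\<in>sections A E T. \<forall>t\<in>sections A E T. \<forall>p. \<forall>v\<in>tangent_space A p.
       nabla (\<lambda>q. s q + t q) p v = nabla s p v + nabla t p v) \<and>
    (\<forall>f\<in>smooth_funs A. \<forall>s\<in>sections A E T. \<forall>p. \<forall>v\<in>tangent_space A p.
       nabla (\<lambda>q. f q *\<^sub>R s q) p v = v f *\<^sub>R s p + f p *\<^sub>R nabla s p v)"

text \<open>
  The extension of \<open>\<nabla>\<close> to \<open>E\<close>-valued 1-forms,
  \<open>(d\<^sup>\<nabla> \<alpha>)(X, Y) = \<nabla>\<^sub>X(\<alpha>(Y)) - \<nabla>\<^sub>Y(\<alpha>(X)) - \<alpha>([X, Y])\<close>. Then \<open>\<nabla>\<^sup>2 s = d\<^sup>\<nabla>(\<nabla>s)\<close>.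
\<close>

definition ext_cov_deriv ::
  "('m, 'v::real_vector) conn \<Rightarrow> ('m \<Rightarrow> 'm tangent \<Rightarrow> 'v)
    \<Rightarrow> ('m \<Rightarrow> 'm tangent) \<Rightarrow> ('m \<Rightarrow> 'm tangent) \<Rightarrow> 'm \<Rightarrow> 'v"
  where "ext_cov_deriv nabla \<alpha> X Y p =
    nabla (\<lambda>q. \<alpha> q (Y q)) p (X p) - nabla (\<lambda>q. \<alpha> q (X q)) p (Y p) - \<alpha> p (bracket X Y p)"

definition nabla_squared ::
  "('m, 'v::real_vector) conn \<Rightarrow> ('m \<Rightarrow> 'v) \<Rightarrow> ('m \<Rightarrow> 'm tangent) \<Rightarrow> ('m \<Rightarrow> 'm tangent) \<Rightarrow> 'm \<Rightarrow> 'v"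
  where "nabla_squared nabla s = ext_cov_deriv nabla (nabla s)"

text \<open>\<open>h\<close> is a 2-form with \<open>\<nabla>\<^sup>2 = h \<otimes> 1\<close>.\<close>

definition is_curvature ::
  "('m, 'e::real_normed_vector) chart set \<Rightarrow> ('m \<Rightarrow> 'v::real_vector set)
    \<Rightarrow> ('m, 'v, 'f::real_normed_vector) trivialization set \<Rightarrow> ('m, 'v) conn
    \<Rightarrow> ('m \<Rightarrow> 'm tangent \<Rightarrow> 'm tangent \<Rightarrow> real) \<Rightarrow> bool"
  where "is_curvature A E T nabla h \<longleftrightarrow>
    two_form A h \<and>
    (\<forall>s\<in>sections A E T. \<forall>X\<in>vector_fields A. \<forall>Y\<in>vector_fields A. \<forall>p.
       nabla_squared nabla s X Y p = h p (X p) (Y p) *\<^sub>R s p)"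

definition projectively_flat ::
  "('m, 'e::real_normed_vector) chart set \<Rightarrow> ('m \<Rightarrow> 'v::real_vector set)
    \<Rightarrow> ('m, 'v, 'f::real_normed_vector) trivialization set \<Rightarrow> ('m, 'v) conn \<Rightarrow> bool"
  where "projectively_flat A E T nabla \<longleftrightarrow> (\<exists>h. is_curvature A E T nabla h)"

definition flat ::
  "('m, 'e::real_normed_vector) chart set \<Rightarrow> ('m \<Rightarrow> 'v::real_vector set)
    \<Rightarrow> ('m, 'v, 'f::real_normed_vector) trivialization set \<Rightarrow> ('m, 'v) conn \<Rightarrow> bool"
  where "flat A E T nabla \<longleftrightarrow>
    (\<forall>s\<in>sections A E T. \<forall>X\<in>vector_fields A. \<forall>Y\<in>vector_fields A. \<forall>p.
       nabla_squared nabla s X Y p = 0)"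

definition conn_minus ::
  "('m, 'v::real_vector) conn \<Rightarrow> ('m \<Rightarrow> 'm tangent \<Rightarrow> real) \<Rightarrow> ('m, 'v) conn"
  where "conn_minus nabla \<omega> = (\<lambda>s p v. nabla s p v - \<omega> p v *\<^sub>R s p)"

end

theory Submission
  imports Defs
begin

text \<open>
  The trace of the local connection matrix \<open>C\<close> satisfies \<open>d (tr C) = n h\<close>, where \<open>n\<close> is the rank, because
  \<open>tr (C \<and> C) = 0\<close>. A change of frame by \<open>g\<close> adds \<open>tr (g\<^sup>-\<^sup>1 dg)\<close> to \<open>tr C\<close>. After choosing any metric on
  \<open>E\<close> and restricting to orthonormal frames, \<open>g\<close> is orthogonal and this term vanishes, so that
  \<open>\<omega> = tr C / n\<close> is a global 1-form with \<open>d\<omega> = h\<close>, and \<open>(\<nabla> - \<omega>)\<^sup>2 = \<nabla>\<^sup>2 - d\<omega> = 0\<close>. The metric need not be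
  compatible with \<open>\<nabla>\<close>.
\<close>

section \<open>Calculus of smooth functions\<close>

text \<open>In arbitrary frames the local forms \<open>tr C / n\<close> differ by d log |det g| / n,
  which is closed but in general not zero, so they do not glue; orthogonal changes have |det g| = 1.
  This is where real scalars enter: for unitary changes of frame tr (g^{-1} dg) is imaginary but
  need not vanish, and the curvature of a complex line bundle need not be exact. The encoding shapes
  the rest of the proof. Tangent vectors are derivations of global functions and
  \<open>nabla\<close> acts on global sections, so neither can be applied to a local frame. A local
  frame is therefore a family of global sections that is orthonormal only near a point. Bump
  functions produce such families, and the locality of derivations and of \<open>nabla\<close>
  allows identities that hold only near p to be differentiated at p. Division by n is possible
  because a nonzero fibre forces positive rank.\<close>

lemma C_diff_subset: "C_diff k S f \<Longrightarrow> T \<subseteq> S \<Longrightarrow> C_diff k T f"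
  by (induction k arbitrary: f) (auto intro: continuous_on_subset)

text \<open>Openness makes equality on \<open>S\<close> pass to the derivatives at points of
  \<open>S\<close>, which is what the induction on \<open>k\<close> needs.\<close>

lemma C_diff_cong:
  assumes "open S" "\<And>x. x \<in> S \<Longrightarrow> f x = g x" "C_diff k S f"
  shows "C_diff k S g"
  using assms(2,3)
proof (induction k arbitrary: f g)
  case 0
  then show ?case by (simp cong: continuous_on_cong)
next
  case (Suc k)
  have D: "(g has_derivative frechet_derivative f (at x)) (at x)" if "x \<in> S" for x
  proof -
    have "(f has_derivative frechet_derivative f (at x)) (at x)"
      using Suc.prems(2) that by (simp add: frechet_derivative_works)
    then show ?thesis
      using has_derivative_transform_within_open[OF _ \<open>open S\<close> that] Suc.prems(1) by blast
  qed
  have "C_diff k S (\<lambda>x. frechet_derivative g (at x) v)" for v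
  proof (rule Suc.IH)
    show "C_diff k S (\<lambda>x. frechet_derivative f (at x) v)"
      using Suc.prems(2) by simp
    show "frechet_derivative f (at x) v = frechet_derivative g (at x) v" if "x \<in> S" for x
      using frechet_derivative_at[OF D[OF that]] by simp
  qed
  with D show ?case by (auto simp: differentiable_def)
qed

text \<open>Replaces the chosen \<open>frechet_derivative\<close> by an explicit formula
  \<open>D\<close>, to which an induction hypothesis on \<open>k\<close> can be applied.\<close>

lemma C_diff_SucI:
  assumes "open S" "\<And>x. x \<in> S \<Longrightarrow> (f has_derivative D x) (at x)"
    and "\<And>v. C_diff k S (\<lambda>x. D x v)"
  shows "C_diff (Suc k) S f"
proof -
  have "C_diff k S (\<lambda>x. frechet_derivative f (at x) v)" for v
    by (rule C_diff_cong[OF assms(1) _ assms(3)[of v]])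
       (use frechet_derivative_at[OF assms(2)] in simp)
  with assms(2) show ?thesis by (auto simp: differentiable_def)
qed

lemma C_diff_Suc_has_derivative:
  assumes "C_diff (Suc k) S f" "x \<in> S"
  shows "(f has_derivative frechet_derivative f (at x)) (at x)"
proof -
  have "f differentiable (at x)" using assms by simp
  then show ?thesis by (rule iffD1[OF frechet_derivative_works])
qed

text \<open>Product and chain rules leave one factor undifferentiated; this lowers its order to that
  of the induction hypothesis.\<close>

lemma C_diff_Suc_imp: "C_diff (Suc k) S f \<Longrightarrow> C_diff k S f"
proof (induction k arbitrary: f)
  case 0
  then show ?case
    by (auto intro!: differentiable_imp_continuous_on differentiable_at_imp_differentiable_on)
next
  case (Suc k)
  then show ?case by (metis C_diff.simps(2))
qed

lemma C_diff_local:
  assumes "\<And>x. x \<in> S \<Longrightarrow> \<exists>N. open N \<and> x \<in> N \<and> C_diff k N f"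
  shows "C_diff k S f"
  using assms
proof (induction k arbitrary: f)
  case 0
  have "isCont f x" if "x \<in> S" for x
    using 0[OF that] by (auto simp: continuous_on_eq_continuous_at)
  then show ?case by (simp add: continuous_at_imp_continuous_on)
next
  case (Suc k)
  have "f differentiable (at x)" if x: "x \<in> S" for x
  proof -
    from Suc.prems[OF x] obtain N where "x \<in> N" "C_diff (Suc k) N f" by blast
    then show ?thesis by simp
  qed
  moreover have "C_diff k S (\<lambda>x. frechet_derivative f (at x) v)" for v
  proof (rule Suc.IH)
    fix x assume "x \<in> S"
    from Suc.prems[OF this] obtain N where "open N" "x \<in> N" "C_diff (Suc k) N f" by blast
    then show "\<exists>N. open N \<and> x \<in> N \<and> C_diff k N (\<lambda>x. frechet_derivative f (at x) v)"
      by (intro exI[of _ N]) simp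
  qed
  ultimately show ?case by simp
qed

lemma C_diff_const: "C_diff k S (\<lambda>x. c)"
  by (induction k arbitrary: c) (auto simp: frechet_derivative_const)

lemma C_diff_add:
  assumes "open S" "C_diff k S f" "C_diff k S g"
  shows "C_diff k S (\<lambda>x. f x + g x)"
  using assms(2,3)
proof (induction k arbitrary: f g)
  case 0
  then show ?case by (simp add: continuous_on_add)
next
  case (Suc k)
  show ?case
  proof (rule C_diff_SucI[OF \<open>open S\<close>])
    show "((\<lambda>x. f x + g x) has_derivative
        (\<lambda>v. frechet_derivative f (at x) v + frechet_derivative g (at x) v)) (at x)"
      if "x \<in> S" for x
      using Suc.prems that by (intro has_derivative_add C_diff_Suc_has_derivative)
    show "C_diff k S (\<lambda>x. frechet_derivative f (at x) v + frechet_derivative g (at x) v)" for v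
      using Suc.prems by (intro Suc.IH) simp_all
  qed
qed

text \<open>The Leibniz rule yields two products of the same kind with lower order. Treating all
  bilinear maps at once covers multiplication, scaling and inner products.\<close>

lemma (in bounded_bilinear) C_diff_bilinear:
  assumes "open S" "C_diff k S f" "C_diff k S g"
  shows "C_diff k S (\<lambda>x. prod (f x) (g x))"
  using assms(2,3)
proof (induction k arbitrary: f g)
  case 0
  then show ?case by (simp add: continuous_on)
next
  case (Suc k)
  show ?case
  proof (rule C_diff_SucI[OF \<open>open S\<close>])
    show "((\<lambda>x. prod (f x) (g x)) has_derivative
        (\<lambda>v. prod (f x) (frechet_derivative g (at x) v) +
             prod (frechet_derivative f (at x) v) (g x))) (at x)"
      if "x \<in> S" for x
      using Suc.prems that by (intro FDERIV C_diff_Suc_has_derivative)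
    show "C_diff k S (\<lambda>x. prod (f x) (frechet_derivative g (at x) v) +
             prod (frechet_derivative f (at x) v) (g x))" for v
      using Suc.prems C_diff_Suc_imp[OF Suc.prems(1)] C_diff_Suc_imp[OF Suc.prems(2)]
      by (intro C_diff_add[OF \<open>open S\<close>] Suc.IH) simp_all
  qed
qed

text \<open>Only outer functions of a real variable are needed, so the chain rule produces a product and
  no expansion in a basis.\<close>

lemma C_diff_compose_real:
  fixes g :: "'a::real_normed_vector \<Rightarrow> real" and \<beta> :: "real \<Rightarrow> real"
  assumes "open S" "open R" "g ` S \<subseteq> R" "C_diff k R \<beta>" "C_diff k S g"
  shows "C_diff k S (\<lambda>x. \<beta> (g x))"
  using assms(4,5)
proof (induction k arbitrary: \<beta>)
  case 0
  then show ?case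
    using continuous_on_compose2[of R \<beta> S g] assms(3) by simp
next
  case (Suc k)
  define \<beta>' where "\<beta>' = (\<lambda>t. frechet_derivative \<beta> (at t) 1)"
  show ?case
  proof (rule C_diff_SucI[OF \<open>open S\<close>])
    show "((\<lambda>x. \<beta> (g x)) has_derivative
        (\<lambda>v. \<beta>' (g x) * frechet_derivative g (at x) v)) (at x)"
      if "x \<in> S" for x
    proof -
      have gx: "g x \<in> R" using that assms(3) by blast
      have D: "(\<beta> has_derivative frechet_derivative \<beta> (at (g x))) (at (g x))"
        using C_diff_Suc_has_derivative[OF Suc.prems(1) gx] .
      have "frechet_derivative \<beta> (at (g x)) w = \<beta>' (g x) * w" for w
      proof -
        have "frechet_derivative \<beta> (at (g x)) (w *\<^sub>R 1) = w *\<^sub>R \<beta>' (g x)"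
          unfolding \<beta>'_def by (rule linear_scale[OF has_derivative_linear[OF D]])
        then show ?thesis by (simp add: mult.commute)
      qed
      then have "frechet_derivative \<beta> (at (g x)) = (\<lambda>w. \<beta>' (g x) * w)" by blast
      with D have "(\<beta> has_derivative (\<lambda>w. \<beta>' (g x) * w)) (at (g x))" by metis
      from has_derivative_compose[OF C_diff_Suc_has_derivative[OF Suc.prems(2) that] this]
      show ?thesis .
    qed
    show "C_diff k S (\<lambda>x. \<beta>' (g x) * frechet_derivative g (at x) v)" for v
    proof (rule bounded_bilinear.C_diff_bilinear[OF bounded_bilinear_mult \<open>open S\<close>])
      have "C_diff k R \<beta>'" using Suc.prems(1) by (simp add: \<beta>'_def)
      then show "C_diff k S (\<lambda>x. \<beta>' (g x))"
        using C_diff_Suc_imp[OF Suc.prems(2)] by (rule Suc.IH)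
      show "C_diff k S (\<lambda>x. frechet_derivative g (at x) v)" using Suc.prems(2) by simp
    qed
  qed
qed

lemma C_diff_SucI_real:
  fixes f :: "real \<Rightarrow> real"
  assumes "open S" "\<And>x. x \<in> S \<Longrightarrow> (f has_real_derivative f' x) (at x)" "C_diff k S f'"
  shows "C_diff (Suc k) S f"
proof (rule C_diff_SucI[OF \<open>open S\<close>])
  show "(f has_derivative (\<lambda>v. f' x * v)) (at x)" if "x \<in> S" for x
    using assms(2)[OF that] by (simp add: has_field_derivative_def)
  show "C_diff k S (\<lambda>x. f' x * v)" for v
    by (intro bounded_bilinear.C_diff_bilinear[OF bounded_bilinear_mult \<open>open S\<close>] assms C_diff_const)
qed

text \<open>With \<open>r\<close> arbitrary the family is closed under differentiation up to
  constants. The exponent -1 serves for the quotient in \<open>cutoff\<close>, the exponent -1/2 for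
  normalising vectors.\<close>

lemma C_diff_powr: "C_diff k {0<..} (\<lambda>x::real. x powr r)"
proof (induction k arbitrary: r)
  case 0
  show ?case by (auto intro!: continuous_intros)
next
  case (Suc k)
  show ?case
    by (rule C_diff_SucI_real[where f' = "\<lambda>x. r * x powr (r - 1)"])
       (auto intro!: bounded_bilinear.C_diff_bilinear[OF bounded_bilinear_mult] Suc C_diff_const
         has_real_derivative_powr)
qed

section \<open>A smooth cutoff function on the real line\<close>

definition flat_exp :: "nat \<Rightarrow> real \<Rightarrow> real"
  where "flat_exp n x = (if x > 0 then exp (- inverse x) * inverse x ^ n else 0)"

text \<open>The substitution y = 1/x turns the limit from the right into that of y^n exp(-y) at
  infinity.\<close>

lemma flat_exp_tendsto_0: "(flat_exp n \<longlongrightarrow> 0) (at 0)"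
proof -
  have "((\<lambda>y. y ^ n * exp (- y)) \<longlongrightarrow> (0::real)) at_top"
    using tendsto_power_div_exp_0[of n] by (simp add: exp_minus field_simps)
  then have "((\<lambda>x. inverse x ^ n * exp (- inverse x)) \<longlongrightarrow> (0::real)) (at_right 0)"
    by (rule filterlim_compose) (rule filterlim_inverse_at_top_right)
  then have "(flat_exp n \<longlongrightarrow> 0) (at_right 0)"
    by (rule Lim_transform_eventually)
       (auto simp: eventually_at_filter flat_exp_def mult.commute)
  moreover have "(flat_exp n \<longlongrightarrow> 0) (at_left 0)"
    by (rule tendsto_eventually) (auto simp: eventually_at_filter flat_exp_def)
  ultimately show ?thesis
    using filterlim_split_at by blast
qed

text \<open>The powers of 1/x are part of \<open>flat_exp\<close> so that derivatives stay inside
  the family; smoothness is then a single induction over all \<open>n\<close>, although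
  \<open>cutoff\<close> uses only \<open>n = 0\<close>.\<close>

lemma flat_exp_deriv:
  "(flat_exp n has_real_derivative flat_exp (n + 2) x - n * flat_exp (n + 1) x) (at x)"
proof (cases "x = 0")
  case True
  \<comment> \<open>At 0 the difference quotient of \<open>flat_exp n\<close> is
    \<open>flat_exp (n + 1)\<close>, whose limit is known.\<close>
  have "((\<lambda>h. flat_exp n h / h) \<longlongrightarrow> 0) (at 0)"
    by (rule Lim_transform_eventually[OF flat_exp_tendsto_0[of "n + 1"]])
       (auto simp: eventually_at_filter flat_exp_def field_simps)
  with True show ?thesis
    by (simp add: DERIV_def flat_exp_def)
next
  case False
  show ?thesis
  proof (cases "x > 0")
    case True
    have "((\<lambda>x. exp (- inverse x) * inverse x ^ n) has_real_derivative
        flat_exp (n + 2) x - n * flat_exp (n + 1) x) (at x)"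
    proof -
      have "((\<lambda>x. exp (- inverse x) * inverse x ^ n) has_real_derivative
          exp (- inverse x) * (inverse x * inverse x) * inverse x ^ n -
          exp (- inverse x) * (n * inverse x ^ (n - 1) * (inverse x * inverse x))) (at x)"
        using True by (auto intro!: derivative_eq_intros)
      moreover have "exp (- inverse x) * (inverse x * inverse x) * inverse x ^ n -
          exp (- inverse x) * (n * inverse x ^ (n - 1) * (inverse x * inverse x)) =
          flat_exp (n + 2) x - n * flat_exp (n + 1) x"
        \<comment> \<open>For \<open>n = 0\<close> the exponent \<open>n - 1\<close> is truncated,
          but the factor \<open>n\<close> removes that term.\<close>
        using True by (cases n) (simp_all add: flat_exp_def algebra_simps)
      ultimately show ?thesis
        by (simp only:)
    qed
    then show ?thesis
      by (rule has_field_derivative_transform_within_open[where S = "{0<..}"])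
         (use True in \<open>auto simp: flat_exp_def\<close>)
  next
    case False
    have "((\<lambda>x. 0) has_real_derivative flat_exp (n + 2) x - n * flat_exp (n + 1) x) (at x)"
      using False by (simp add: flat_exp_def)
    then show ?thesis
      by (rule has_field_derivative_transform_within_open[where S = "{..<0}"])
         (use False \<open>x \<noteq> 0\<close> in \<open>auto simp: flat_exp_def\<close>)
  qed
qed

lemma C_diff_flat_exp: "C_diff k UNIV (flat_exp n)"
proof (induction k arbitrary: n)
  case 0
  have "isCont (flat_exp n) x" for x
    using flat_exp_deriv DERIV_isCont by blast
  then show ?case by (simp add: continuous_at_imp_continuous_on)
next
  case (Suc k)
  have "C_diff k UNIV (\<lambda>x. flat_exp (n + 2) x + (- real n) * flat_exp (n + 1) x)"
    by (intro C_diff_add bounded_bilinear.C_diff_bilinear[OF bounded_bilinear_mult] Suc C_diff_const)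
       auto
  then show ?case
    by (intro C_diff_SucI_real[OF _ flat_exp_deriv]) auto
qed

definition cutoff :: "real \<Rightarrow> real"
  where "cutoff t = flat_exp 0 (2 - t) / (flat_exp 0 (2 - t) + flat_exp 0 (t - 1))"

text \<open>The arguments 2 - t and t - 1 add up to 1, so at least one of them is positive.\<close>

lemma cutoff_denom_pos: "flat_exp 0 (2 - t) + flat_exp 0 (t - 1) > 0"
  by (auto simp: flat_exp_def add_pos_pos)

lemma cutoff_bounds: "0 \<le> cutoff t" "cutoff t \<le> 1"
  using cutoff_denom_pos[of t] by (auto simp: cutoff_def flat_exp_def field_simps)

lemma cutoff_eq_1: "t \<le> 1 \<Longrightarrow> cutoff t = 1"
  by (simp add: cutoff_def flat_exp_def)

lemma cutoff_eq_0: "t \<ge> 2 \<Longrightarrow> cutoff t = 0"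
  by (simp add: cutoff_def flat_exp_def)

lemma C_diff_id: "C_diff k UNIV (\<lambda>x::real. x)"
  by (cases k) (auto intro!: C_diff_SucI_real[where f' = "\<lambda>_. 1"] C_diff_const simp del: C_diff.simps(2))

lemma C_diff_cutoff: "C_diff k UNIV cutoff"
proof -
  have a: "C_diff k UNIV (\<lambda>t. flat_exp 0 (2 - t))"
    using C_diff_add[OF _ C_diff_const[of k UNIV 2]
        bounded_bilinear.C_diff_bilinear[OF bounded_bilinear_mult _ C_diff_const[of k UNIV "-1"] C_diff_id]]
    by (intro C_diff_compose_real[OF _ _ _ C_diff_flat_exp]) auto
  have b: "C_diff k UNIV (\<lambda>t. flat_exp 0 (t - 1))"
    using C_diff_add[OF _ C_diff_id C_diff_const[of k UNIV "-1"]]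
    by (intro C_diff_compose_real[OF _ _ _ C_diff_flat_exp]) auto
  have c: "C_diff k UNIV (\<lambda>t. (flat_exp 0 (2 - t) + flat_exp 0 (t - 1)) powr (- 1))"
    by (rule C_diff_compose_real[OF _ _ _ C_diff_powr]) (auto simp: cutoff_denom_pos intro!: C_diff_add a b)
  \<comment> \<open>Positivity of the denominator turns the quotient into a product with a power,
    which \<open>C_diff_powr\<close> covers.\<close>
  have "cutoff = (\<lambda>t. flat_exp 0 (2 - t) * (flat_exp 0 (2 - t) + flat_exp 0 (t - 1)) powr (- 1))"
    using cutoff_denom_pos
    by (auto simp: cutoff_def fun_eq_iff powr_minus_divide less_imp_le abs_of_pos)
  then show ?thesis
    using bounded_bilinear.C_diff_bilinear[OF bounded_bilinear_mult _ a c] by simp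
qed

section \<open>Smooth functions on a manifold\<close>

text \<open>Finite dimension comes from compactness of the unit ball. Finitely many balls of radius
  1/2 cover it, and two orthonormal vectors, at distance sqrt 2 > 1, never share one; this bounds
  the size of orthonormal sets. One of maximal size spans, because a nonzero residual could be
  normalised and added.\<close>

lemma finite_orthonormal_basis_exists:
  "\<exists>B::'f::{real_inner, heine_borel} set. finite B \<and>
     (\<forall>b\<in>B. \<forall>c\<in>B. b \<bullet> c = (if b = c then 1 else 0)) \<and> (\<forall>x. x = (\<Sum>b\<in>B. (x \<bullet> b) *\<^sub>R b))"
proof -
  define ON where "ON = (\<lambda>B::'f set. finite B \<and> (\<forall>b\<in>B. \<forall>c\<in>B. b \<bullet> c = (if b = c then 1 else 0)))"
  have "compact (cball (0::'f) 1)"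
    by (simp add: compact_eq_bounded_closed)
  then have "\<forall>e>0. \<exists>K. finite K \<and> cball (0::'f) 1 \<subseteq> (\<Union>x\<in>K. ball x e)"
    unfolding compact_eq_totally_bounded by (rule conjunct2)
  from this[rule_format, of "1/2"]
  obtain K where K: "finite K" "cball (0::'f) 1 \<subseteq> (\<Union>x\<in>K. ball x (1/2))" by auto
  have bound: "card B \<le> card K" if "ON B" for B
  proof -
    have "\<exists>x\<in>K. b \<in> ball x (1/2)" if "b \<in> B" for b
    proof -
      have "b \<bullet> b = 1" using \<open>ON B\<close> that by (auto simp: ON_def)
      then have "b \<in> cball 0 1" by (simp add: norm_eq_sqrt_inner)
      then show ?thesis using K(2) by blast
    qed
    then obtain x where x: "\<And>b. b \<in> B \<Longrightarrow> x b \<in> K \<and> b \<in> ball (x b) (1/2)" by metis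
    have "inj_on x B"
    proof (rule inj_onI, rule ccontr)
      fix b c assume bc: "b \<in> B" "c \<in> B" "x b = x c" "b \<noteq> c"
      have "dist b c \<le> dist (x b) b + dist (x b) c"
        by (metis dist_commute dist_triangle)
      also have "\<dots> < 1" using x[OF bc(1)] x[OF bc(2)] bc(3) by simp
      finally have "norm (b - c) < 1" by (simp add: dist_norm)
      then have "(norm (b - c))\<^sup>2 < 1" by (simp add: power_less_one_iff)
      moreover have "b \<bullet> b = 1" "c \<bullet> c = 1" "b \<bullet> c = 0"
        using \<open>ON B\<close> bc by (auto simp: ON_def)
      then have "(norm (b - c))\<^sup>2 = 2"
        by (simp add: power2_norm_eq_inner inner_diff inner_commute)
      ultimately show False by simp
    qed
    then show ?thesis using card_inj_on_le[of x B K] x K(1) by blast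
  qed
  have "ON {}" by (simp add: ON_def)
  then have "\<exists>B. ON B \<and> (\<forall>C. ON C \<longrightarrow> card C \<le> card B)"
    \<comment> \<open>The rule asks for a strict upper bound, hence \<open>Suc\<close>.\<close>
    by (rule ex_has_greatest_nat[where b = "Suc (card K)"]) (use bound in \<open>auto simp: less_Suc_eq_le\<close>)
  then obtain B where B: "ON B" and max: "\<And>C. ON C \<Longrightarrow> card C \<le> card B"
    by blast
  have "x = (\<Sum>b\<in>B. (x \<bullet> b) *\<^sub>R b)" for x
  proof (rule ccontr)
    define y where "y = x - (\<Sum>b\<in>B. (x \<bullet> b) *\<^sub>R b)"
    assume "x \<noteq> (\<Sum>b\<in>B. (x \<bullet> b) *\<^sub>R b)"
    then have "y \<noteq> 0" by (simp add: y_def)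
    have orth: "y \<bullet> c = 0" if "c \<in> B" for c
    proof -
      have "(\<Sum>b\<in>B. (x \<bullet> b) * (b \<bullet> c)) = (\<Sum>b\<in>B. if b = c then x \<bullet> c else 0)"
        using B that by (intro sum.cong) (auto simp: ON_def)
      also have "\<dots> = x \<bullet> c" using B that by (simp add: ON_def)
      finally show ?thesis by (simp add: y_def inner_diff_left inner_sum_left)
    qed
    define z where "z = (1 / norm y) *\<^sub>R y"
    have z: "z \<bullet> z = 1" "\<And>c. c \<in> B \<Longrightarrow> z \<bullet> c = 0"
      using \<open>y \<noteq> 0\<close> orth by (simp_all add: z_def power2_norm_eq_inner[symmetric] power2_eq_square)
    have "z \<notin> B" using z by force
    have "ON (insert z B)"
      using B z unfolding ON_def by (auto simp: inner_commute)
    then have "card (insert z B) \<le> card B" by (rule max)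
    then show False using \<open>z \<notin> B\<close> B by (simp add: ON_def)
  qed
  with B show ?thesis unfolding ON_def by blast
qed

section \<open>Functions that are smooth in every chart\<close>

locale smooth_manifold =
  fixes A :: "('m::{t2_space, second_countable_topology}, 'e::{real_inner, heine_borel}) chart set"
  assumes atlas: "smooth_atlas A"
begin

lemma chartD:
  assumes "(U, \<phi>) \<in> A"
  shows "open U" "homeomorphism U (\<phi> ` U) \<phi> (inv_into U \<phi>)" "open (\<phi> ` U)"
  using atlas assms by (auto simp: smooth_atlas_def is_chart_def)

lemma chart_inverse:
  assumes "(U, \<phi>) \<in> A" "q \<in> U"
  shows "inv_into U \<phi> (\<phi> q) = q"
  using chartD(2)[OF assms(1)] assms(2) by (simp add: homeomorphism_apply1)

text \<open>Smoothness is tested on these sets, and most \<open>C_diff\<close> rules ask for an open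
  domain.\<close>

lemma chart_open_image:
  assumes "(U, \<phi>) \<in> A" "open W"
  shows "open (\<phi> ` (U \<inter> W))"
proof -
  have "openin (top_of_set (\<phi> ` U)) (\<phi> ` (U \<inter> W))"
    by (rule homeomorphism_imp_open_map[OF chartD(2)[OF assms(1)]])
       (use assms(2) in \<open>simp add: openin_open_Int\<close>)
  then show ?thesis using chartD(3)[OF assms(1)] by (rule openin_open_trans)
qed

lemma smooth_fun_onI:
  "(\<And>U \<phi> k. (U, \<phi>) \<in> A \<Longrightarrow> C_diff k (\<phi> ` (U \<inter> W)) (\<lambda>x. f (inv_into U \<phi> x))) \<Longrightarrow> smooth_fun_on A W f"
  by (auto simp: smooth_fun_on_def smooth_on_def o_def)

lemma smooth_fun_onD:
  "smooth_fun_on A W f \<Longrightarrow> (U, \<phi>) \<in> A \<Longrightarrow> C_diff k (\<phi> ` (U \<inter> W)) (\<lambda>x. f (inv_into U \<phi> x))"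
  by (auto simp: smooth_fun_on_def smooth_on_def o_def)

text \<open>Read in another chart, a coordinate map is a transition map of the atlas.\<close>

lemma smooth_fun_on_chart: "(U, \<phi>) \<in> A \<Longrightarrow> smooth_fun_on A U \<phi>"
  using atlas by (fastforce simp: smooth_fun_on_def smooth_atlas_def)

lemma smooth_fun_on_subset: "smooth_fun_on A W f \<Longrightarrow> V \<subseteq> W \<Longrightarrow> smooth_fun_on A V f"
  by (rule smooth_fun_onI, rule C_diff_subset, rule smooth_fun_onD) auto

lemma smooth_fun_on_cong:
  assumes "open W" "\<And>q. q \<in> W \<Longrightarrow> f q = g q" "smooth_fun_on A W f"
  shows "smooth_fun_on A W g"
proof (rule smooth_fun_onI)
  fix U \<phi> k assume c: "(U, \<phi>) \<in> A"
  show "C_diff k (\<phi> ` (U \<inter> W)) (\<lambda>x. g (inv_into U \<phi> x))"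
    by (rule C_diff_cong[OF chart_open_image[OF c assms(1)] _ smooth_fun_onD[OF assms(3) c]])
       (use assms(2) chart_inverse[OF c] in auto)
qed

lemma smooth_fun_on_local:
  assumes "\<And>p. p \<in> W \<Longrightarrow> \<exists>N. open N \<and> p \<in> N \<and> smooth_fun_on A N f"
  shows "smooth_fun_on A W f"
proof (rule smooth_fun_onI, rule C_diff_local)
  fix U \<phi> k x assume c: "(U, \<phi>) \<in> A" and "x \<in> \<phi> ` (U \<inter> W)"
  then obtain p where p: "p \<in> U" "p \<in> W" "x = \<phi> p" by auto
  then obtain N where N: "open N" "p \<in> N" "smooth_fun_on A N f" using assms by blast
  show "\<exists>S. open S \<and> x \<in> S \<and> C_diff k S (\<lambda>x. f (inv_into U \<phi> x))"
    using chart_open_image[OF c N(1)] smooth_fun_onD[OF N(3) c] p N(2) by blast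
qed

lemma smooth_fun_on_const: "smooth_fun_on A W (\<lambda>q. c)"
  by (rule smooth_fun_onI, rule C_diff_const)

lemma smooth_fun_on_add:
  assumes "open W" "smooth_fun_on A W f" "smooth_fun_on A W g"
  shows "smooth_fun_on A W (\<lambda>q. f q + g q)"
  by (rule smooth_fun_onI, rule C_diff_add) (use assms in \<open>auto intro: chart_open_image smooth_fun_onD\<close>)

lemma smooth_fun_on_bilinear:
  assumes "bounded_bilinear pr" "open W" "smooth_fun_on A W f" "smooth_fun_on A W g"
  shows "smooth_fun_on A W (\<lambda>q. pr (f q) (g q))"
  by (rule smooth_fun_onI, rule bounded_bilinear.C_diff_bilinear[OF assms(1)])
     (use assms in \<open>auto intro: chart_open_image smooth_fun_onD\<close>)

lemmas smooth_fun_on_mult = smooth_fun_on_bilinear[OF bounded_bilinear_mult]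
lemmas smooth_fun_on_scaleR = smooth_fun_on_bilinear[OF bounded_bilinear_scaleR]
lemmas smooth_fun_on_inner = smooth_fun_on_bilinear[OF bounded_bilinear_inner]

lemma smooth_fun_on_diff:
  assumes "open W" "smooth_fun_on A W f" "smooth_fun_on A W g"
  shows "smooth_fun_on A W (\<lambda>q. f q - g q)"
  using smooth_fun_on_add[OF assms(1,2) smooth_fun_on_scaleR[OF assms(1) smooth_fun_on_const assms(3)], of "- 1"]
  by simp

lemma smooth_fun_on_sum:
  assumes "open W" "\<And>i. i \<in> I \<Longrightarrow> smooth_fun_on A W (f i)"
  shows "smooth_fun_on A W (\<lambda>q. \<Sum>i\<in>I. f i q)"
  using assms(2)
proof (induction I rule: infinite_finite_induct)
  case (insert i I)
  then show ?case by (simp add: smooth_fun_on_add[OF assms(1)])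
qed (simp_all add: smooth_fun_on_const)

lemma smooth_fun_on_prod:
  fixes f :: "'i \<Rightarrow> 'm \<Rightarrow> real"
  assumes "open W" "\<And>i. i \<in> I \<Longrightarrow> smooth_fun_on A W (f i)"
  shows "smooth_fun_on A W (\<lambda>q. \<Prod>i\<in>I. f i q)"
  using assms(2)
proof (induction I rule: infinite_finite_induct)
  case (insert i I)
  then show ?case by (simp add: smooth_fun_on_mult[OF assms(1)])
qed (simp_all add: smooth_fun_on_const)

lemma smooth_fun_on_compose_real:
  fixes f :: "'m \<Rightarrow> real" and \<beta> :: "real \<Rightarrow> real"
  assumes "open W" "open R" "f ` W \<subseteq> R" "\<And>k. C_diff k R \<beta>" "smooth_fun_on A W f"
  shows "smooth_fun_on A W (\<lambda>q. \<beta> (f q))"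
proof (rule smooth_fun_onI)
  fix U \<phi> k assume c: "(U, \<phi>) \<in> A"
  show "C_diff k (\<phi> ` (U \<inter> W)) (\<lambda>x. \<beta> (f (inv_into U \<phi> x)))"
    by (rule C_diff_compose_real[OF chart_open_image[OF c assms(1)] assms(2) _ assms(4)
          smooth_fun_onD[OF assms(5) c]])
       (use assms(3) chart_inverse[OF c] in auto)
qed

text \<open>Serves mainly for extension by zero: \<open>f\<close> is smooth on \<open>U\<close> by
  its formula and vanishes on \<open>V\<close>.\<close>

lemma smooth_fun_on_union:
  assumes "open U" "smooth_fun_on A U f" "open V" "smooth_fun_on A V f" "W \<subseteq> U \<union> V"
  shows "smooth_fun_on A W f"
  by (rule smooth_fun_on_local) (use assms in blast)

lemma smooth_fun_on_zero:
  assumes "open V" "\<And>q. q \<in> V \<Longrightarrow> f q = 0"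
  shows "smooth_fun_on A V f"
  by (rule smooth_fun_on_cong[OF assms(1) _ smooth_fun_on_const[of V 0]]) (simp add: assms(2))

text \<open>The function is a cutoff of the squared coordinate distance from p. The open set
  \<open>Z\<close> takes the place of a statement about supports: every point outside
  \<open>W\<close> has a neighbourhood on which \<open>\<rho>\<close> vanishes, which is what
  extension by zero requires.\<close>

lemma bump_function_exists:
  assumes "open W" "p \<in> W"
  obtains \<rho> V Z where "\<rho> \<in> smooth_funs A" "\<And>q. 0 \<le> \<rho> q \<and> \<rho> q \<le> 1"
    "open V" "p \<in> V" "\<And>q. q \<in> V \<Longrightarrow> \<rho> q = 1"
    "open Z" "W \<union> Z = UNIV" "\<And>q. q \<in> Z \<Longrightarrow> \<rho> q = 0"
proof -
  have "p \<in> (\<Union>(U, \<phi>)\<in>A. U)" using atlas by (simp add: smooth_atlas_def)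
  then obtain U \<phi> where c: "(U, \<phi>) \<in> A" and pU: "p \<in> U" by auto
  have "open (\<phi> ` (U \<inter> W))" "\<phi> p \<in> \<phi> ` (U \<inter> W)"
    using chart_open_image[OF c assms(1)] pU assms(2) by auto
  then obtain e where e: "e > 0" "cball (\<phi> p) e \<subseteq> \<phi> ` (U \<inter> W)"
    using open_contains_cball by metis
  define K where "K = inv_into U \<phi> ` cball (\<phi> p) e"
  \<comment> \<open>Scaled so that distance e gives 2, where \<open>cutoff\<close> is 0, and
    distance at most e/2 gives at most 1/2, where \<open>cutoff\<close> is 1.\<close>
  define g where "g = (\<lambda>q. 2 / e\<^sup>2 * ((\<phi> q - \<phi> p) \<bullet> (\<phi> q - \<phi> p)))"
  define \<rho> where "\<rho> = (\<lambda>q. if q \<in> U then cutoff (g q) else 0)"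
  have sub: "cball (\<phi> p) e \<subseteq> \<phi> ` U" using e(2) by blast
  have "continuous_on (\<phi> ` U) (inv_into U \<phi>)"
    using chartD(2)[OF c] by (simp add: homeomorphism_def)
  then have "compact K"
    unfolding K_def using sub
    by (intro compact_continuous_image continuous_on_subset[of "\<phi> ` U" _ "cball (\<phi> p) e"])
       (auto simp: compact_eq_bounded_closed)
  \<comment> \<open>The Hausdorff property enters here: \<open>K\<close> is closed in the whole
    manifold and not only in \<open>U\<close>, so the extension by 0 is smooth also at the boundary
    of \<open>U\<close>.\<close>
  then have "closed K" by (rule compact_imp_closed)
  have KW: "K \<subseteq> W"
  proof
    fix q assume "q \<in> K"
    then obtain x where "x \<in> cball (\<phi> p) e" "q = inv_into U \<phi> x" by (auto simp: K_def)
    then obtain r where "r \<in> U" "r \<in> W" "q = inv_into U \<phi> (\<phi> r)" using e(2) by blast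
    then show "q \<in> W" using chart_inverse[OF c] by simp
  qed
  have "smooth_fun_on A U g"
    unfolding g_def
    by (intro smooth_fun_on_mult smooth_fun_on_inner smooth_fun_on_diff smooth_fun_on_const
        smooth_fun_on_chart[OF c] chartD(1)[OF c])
  then have gU: "smooth_fun_on A U (\<lambda>q. cutoff (g q))"
    by (rule smooth_fun_on_compose_real[OF chartD(1)[OF c] open_UNIV subset_UNIV C_diff_cutoff])
  have \<rho>U: "smooth_fun_on A U \<rho>"
    by (rule smooth_fun_on_cong[OF chartD(1)[OF c] _ gU]) (simp add: \<rho>_def)
  have zero: "\<rho> q = 0" if "q \<in> - K" for q
  proof (cases "q \<in> U")
    case True
    have "\<phi> q \<notin> cball (\<phi> p) e"
      using that chart_inverse[OF c True] unfolding K_def by force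
    then have "e < norm (\<phi> q - \<phi> p)" by (simp add: dist_norm norm_minus_commute)
    then have "e\<^sup>2 \<le> (\<phi> q - \<phi> p) \<bullet> (\<phi> q - \<phi> p)"
      using e(1) by (simp add: power2_norm_eq_inner[symmetric] power_mono)
    then have "g q \<ge> 2" using e(1) by (simp add: g_def field_simps)
    then show ?thesis by (simp add: \<rho>_def cutoff_eq_0)
  qed (simp add: \<rho>_def)
  have "K \<subseteq> U"
  proof
    fix q assume "q \<in> K"
    then obtain x where "x \<in> \<phi> ` U" "q = inv_into U \<phi> x" using sub unfolding K_def by blast
    then show "q \<in> U" by (simp add: inv_into_into)
  qed
  have smooth: "\<rho> \<in> smooth_funs A"
    unfolding smooth_funs_def mem_Collect_eq
    by (rule smooth_fun_on_union[OF chartD(1)[OF c] \<rho>U, of "- K"])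
       (use \<open>closed K\<close> \<open>K \<subseteq> U\<close> zero in \<open>auto intro!: smooth_fun_on_zero\<close>)
  have contU: "continuous_on U \<phi>"
    using chartD(2)[OF c] by (simp add: homeomorphism_def)
  have "open (U \<inter> \<phi> -` ball (\<phi> p) (e / 2))"
    by (rule continuous_open_preimage[OF contU chartD(1)[OF c] open_ball])
  moreover have "\<rho> q = 1" if "q \<in> U \<inter> \<phi> -` ball (\<phi> p) (e / 2)" for q
  proof -
    have "norm (\<phi> q - \<phi> p) \<le> e / 2" using that by (simp add: dist_norm norm_minus_commute)
    then have "(\<phi> q - \<phi> p) \<bullet> (\<phi> q - \<phi> p) \<le> (e / 2)\<^sup>2"
      by (simp add: power2_norm_eq_inner[symmetric] power_mono)
    also have "\<dots> \<le> e\<^sup>2 / 2" by (simp add: power_divide)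
    finally have "g q \<le> 1" using e(1) by (simp add: g_def field_simps)
    then show ?thesis using that by (simp add: \<rho>_def cutoff_eq_1)
  qed
  moreover have "0 \<le> \<rho> q \<and> \<rho> q \<le> 1" for q
    by (simp add: \<rho>_def cutoff_bounds)
  ultimately show thesis
    using smooth zero KW \<open>closed K\<close> pU e(1)
    by (intro that[of \<rho> "U \<inter> \<phi> -` ball (\<phi> p) (e / 2)" "- K"]) auto
qed

lemma smooth_funs_iff: "f \<in> smooth_funs A \<longleftrightarrow> smooth_fun_on A UNIV f"
  by (simp add: smooth_funs_def)

lemma smooth_funs_restrict: "f \<in> smooth_funs A \<Longrightarrow> smooth_fun_on A W f"
  unfolding smooth_funs_iff by (erule smooth_fun_on_subset) (rule subset_UNIV)

lemma smooth_funs_const: "(\<lambda>q. c) \<in> smooth_funs A"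
  by (simp add: smooth_funs_iff smooth_fun_on_const)

lemma smooth_funs_mult:
  "f \<in> smooth_funs A \<Longrightarrow> g \<in> smooth_funs A \<Longrightarrow> (\<lambda>q. f q * g q) \<in> smooth_funs A"
  by (simp add: smooth_funs_iff smooth_fun_on_mult)

lemma smooth_funs_diff:
  "f \<in> smooth_funs A \<Longrightarrow> g \<in> smooth_funs A \<Longrightarrow> (\<lambda>q. f q - g q) \<in> smooth_funs A"
  by (simp add: smooth_funs_iff smooth_fun_on_diff)

lemma smooth_funs_sum:
  "(\<And>i. i \<in> I \<Longrightarrow> f i \<in> smooth_funs A) \<Longrightarrow> (\<lambda>q. \<Sum>i\<in>I. f i q) \<in> smooth_funs A"
  unfolding smooth_funs_iff by (rule smooth_fun_on_sum) auto

lemma smooth_funs_local: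
  assumes "\<And>p. \<exists>N g. open N \<and> p \<in> N \<and> (\<forall>q\<in>N. f q = g q) \<and> g \<in> smooth_funs A"
  shows "f \<in> smooth_funs A"
  unfolding smooth_funs_iff
proof (rule smooth_fun_on_local)
  fix p
  obtain N g where N: "open N" "p \<in> N" "\<And>q. q \<in> N \<Longrightarrow> f q = g q" and g: "g \<in> smooth_funs A"
    using assms[of p] by blast
  have "smooth_fun_on A N g" by (rule smooth_funs_restrict[OF g])
  with N have "smooth_fun_on A N f" by (intro smooth_fun_on_cong[of N g f]) auto
  with N show "\<exists>N. open N \<and> p \<in> N \<and> smooth_fun_on A N f" by blast
qed

lemma smooth_fun_continuous:
  fixes f :: "'m \<Rightarrow> real"
  assumes "f \<in> smooth_funs A"
  shows "continuous_on UNIV f"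
proof (rule continuous_at_imp_continuous_on, rule ballI)
  fix p :: 'm
  have "p \<in> (\<Union>(U, \<phi>)\<in>A. U)" using atlas by (simp add: smooth_atlas_def)
  then obtain U \<phi> where c: "(U, \<phi>) \<in> A" and pU: "p \<in> U" by auto
  have "C_diff 0 (\<phi> ` (U \<inter> UNIV)) (\<lambda>x. f (inv_into U \<phi> x))"
    using assms c unfolding smooth_funs_iff by (rule smooth_fun_onD)
  then have "continuous_on (\<phi> ` U) (\<lambda>x. f (inv_into U \<phi> x))" by simp
  moreover have "continuous_on U \<phi>" using chartD(2)[OF c] by (simp add: homeomorphism_def)
  ultimately have "continuous_on U (\<lambda>q. f (inv_into U \<phi> (\<phi> q)))"
    by (rule continuous_on_compose2) simp
  then have "continuous_on U f"
    by (rule continuous_on_eq) (simp add: chart_inverse[OF c])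
  then show "isCont f p" using continuous_on_eq_continuous_at[OF chartD(1)[OF c]] pU by blast
qed

section \<open>Tangent vectors as derivations of global functions\<close>

lemma tangent_add:
  "v \<in> tangent_space A p \<Longrightarrow> f \<in> smooth_funs A \<Longrightarrow> g \<in> smooth_funs A \<Longrightarrow>
    v (\<lambda>q. f q + g q) = v f + v g"
  by (simp add: tangent_space_def)

lemma tangent_cmult:
  "v \<in> tangent_space A p \<Longrightarrow> f \<in> smooth_funs A \<Longrightarrow> v (\<lambda>q. c * f q) = c * v f"
  by (simp add: tangent_space_def)

lemma tangent_mult:
  "v \<in> tangent_space A p \<Longrightarrow> f \<in> smooth_funs A \<Longrightarrow> g \<in> smooth_funs A \<Longrightarrow>
    v (\<lambda>q. f q * g q) = f p * v g + g p * v f"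
  by (simp add: tangent_space_def)

lemma tangent_nonsmooth: "v \<in> tangent_space A p \<Longrightarrow> f \<notin> smooth_funs A \<Longrightarrow> v f = 0"
  by (simp add: tangent_space_def)

text \<open>The product rule for 1 = 1 * 1 gives v(1) = 2 v(1).\<close>

lemma tangent_const:
  assumes v: "v \<in> tangent_space A p"
  shows "v (\<lambda>q. c) = 0"
proof -
  have "v (\<lambda>q. 1) = 0"
    using tangent_mult[OF v smooth_funs_const[of 1] smooth_funs_const[of 1]] by simp
  then show ?thesis
    using tangent_cmult[OF v smooth_funs_const[of 1], of c] by simp
qed

lemma tangent_diff:
  assumes v: "v \<in> tangent_space A p" and f: "f \<in> smooth_funs A" and g: "g \<in> smooth_funs A"
  shows "v (\<lambda>q. f q - g q) = v f - v g"
  using tangent_add[OF v smooth_funs_diff[OF f g] g] by simp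

lemma tangent_sum:
  assumes v: "v \<in> tangent_space A p" and f: "\<And>i. i \<in> I \<Longrightarrow> f i \<in> smooth_funs A"
  shows "v (\<lambda>q. \<Sum>i\<in>I. f i q) = (\<Sum>i\<in>I. v (f i))"
  using f
proof (induction I rule: infinite_finite_induct)
  case (insert i I)
  then show ?case by (simp add: tangent_add[OF v] smooth_funs_sum)
qed (simp_all add: tangent_const[OF v])

text \<open>For a bump function \<open>\<rho>\<close> at p with support in \<open>N\<close>, the
  product \<open>\<rho> * (f - g)\<close> is the zero function. Since \<open>\<rho>\<close> is 1 and
  f - g is 0 at p, the product rule evaluates \<open>v\<close> on it to v f - v g.\<close>

lemma tangent_local:
  assumes v: "v \<in> tangent_space A p" and f: "f \<in> smooth_funs A" and g: "g \<in> smooth_funs A"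
    and N: "open N" "p \<in> N" and eq: "\<And>q. q \<in> N \<Longrightarrow> f q = g q"
  shows "v f = v g"
proof -
  obtain \<rho> V Z where \<rho>: "\<rho> \<in> smooth_funs A" "p \<in> V" "\<And>q. q \<in> V \<Longrightarrow> \<rho> q = 1"
    "N \<union> Z = UNIV" "\<And>q. q \<in> Z \<Longrightarrow> \<rho> q = 0"
    using bump_function_exists[OF N] by metis
  have "(\<lambda>q. \<rho> q * (f q - g q)) = (\<lambda>q. 0)"
    using \<rho>(4,5) eq by fastforce
  then have "v (\<lambda>q. \<rho> q * (f q - g q)) = 0"
    using tangent_const[OF v] by simp
  moreover have "v (\<lambda>q. \<rho> q * (f q - g q)) = v f - v g"
    using tangent_mult[OF v \<rho>(1) smooth_funs_diff[OF f g]] tangent_diff[OF v f g] \<rho>(2,3) eq[OF N(2)]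
    by simp
  ultimately show ?thesis by simp
qed

lemma vector_field_tangent: "X \<in> vector_fields A \<Longrightarrow> X p \<in> tangent_space A p"
  by (simp add: vector_fields_def)

lemma vector_field_smooth:
  "X \<in> vector_fields A \<Longrightarrow> f \<in> smooth_funs A \<Longrightarrow> (\<lambda>p. X p f) \<in> smooth_funs A"
  by (simp add: vector_fields_def)

text \<open>The mixed terms X f * Y g + X g * Y f of the iterated product rule are symmetric in
  \<open>X\<close> and \<open>Y\<close> and cancel in the commutator.\<close>

lemma bracket_tangent:
  assumes X: "X \<in> vector_fields A" and Y: "Y \<in> vector_fields A"
  shows "bracket X Y p \<in> tangent_space A p"
proof -
  note tX = vector_field_tangent[OF X] and tY = vector_field_tangent[OF Y]
  note sX = vector_field_smooth[OF X] and sY = vector_field_smooth[OF Y]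
  have "bracket X Y p (\<lambda>q. f q + g q) = bracket X Y p f + bracket X Y p g"
    if "f \<in> smooth_funs A" "g \<in> smooth_funs A" for f g
    using that sX sY by (simp add: bracket_def tangent_add[OF tX] tangent_add[OF tY])
  moreover have "bracket X Y p (\<lambda>q. c * f q) = c * bracket X Y p f"
    if "f \<in> smooth_funs A" for c f
    using that sX sY
    by (simp add: bracket_def tangent_cmult[OF tX] tangent_cmult[OF tY] algebra_simps)
  moreover have "bracket X Y p (\<lambda>q. f q * g q) = f p * bracket X Y p g + g p * bracket X Y p f"
    if "f \<in> smooth_funs A" "g \<in> smooth_funs A" for f g
    using that sX sY
    by (simp add: bracket_def tangent_add[OF tX] tangent_add[OF tY] tangent_mult[OF tX]
        tangent_mult[OF tY] smooth_funs_mult algebra_simps)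
  \<comment> \<open>For nonsmooth \<open>f\<close> both inner functions are constantly 0, so the
    prescribed default value survives.\<close>
  moreover have "bracket X Y p f = 0" if "f \<notin> smooth_funs A" for f
    using that by (simp add: bracket_def tangent_nonsmooth[OF tX] tangent_nonsmooth[OF tY]
        tangent_const[OF tX] tangent_const[OF tY])
  ultimately show ?thesis unfolding tangent_space_def by blast
qed

end

section \<open>Sections of a vector bundle\<close>

text \<open>\<open>B\<close> is an orthonormal basis of the model fibre, fixed once. It expands
  fibre coordinates and later indexes all frames, so \<open>card B\<close> is the rank.\<close>

locale smooth_vector_bundle = smooth_manifold A
  for A :: "('m::{t2_space, second_countable_topology}, 'e::{real_inner, heine_borel}) chart set" +
  fixes E :: "'m \<Rightarrow> 'v::real_vector set"
    and T :: "('m, 'v, 'f::{real_inner, heine_borel}) trivialization set"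
    and B :: "'f set"
  assumes vector_bundle: "vector_bundle A E T"
    and finite_B: "finite B"
    and orthonormal_B: "\<And>b c. b \<in> B \<Longrightarrow> c \<in> B \<Longrightarrow> b \<bullet> c = (if b = c then 1 else 0)"
    and expand_B: "\<And>x. x = (\<Sum>b\<in>B. (x \<bullet> b) *\<^sub>R b)"
begin

section \<open>Linear algebra in the fibres\<close>

lemma subspace_E: "subspace (E p)"
  using vector_bundle by (simp add: vector_bundle_def)

lemmas E_closed = subspace_add[OF subspace_E] subspace_scale[OF subspace_E]
  subspace_diff[OF subspace_E] subspace_0[OF subspace_E] subspace_sum[OF subspace_E]

lemma trivialization_at: obtains U \<tau> where "(U, \<tau>) \<in> T" "p \<in> U"
proof -
  have "p \<in> (\<Union>(U, \<tau>)\<in>T. U)" using vector_bundle by (simp add: vector_bundle_def)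
  then show ?thesis using that by auto
qed

lemma trivializationD:
  assumes "(U, \<tau>) \<in> T"
  shows "open U" "p \<in> U \<Longrightarrow> linear (\<tau> p)" "p \<in> U \<Longrightarrow> bij_betw (\<tau> p) UNIV (E p)"
proof -
  have "\<forall>(U, \<tau>)\<in>T. open U \<and> (\<forall>p\<in>U. linear (\<tau> p) \<and> bij_betw (\<tau> p) UNIV (E p))"
    using vector_bundle unfolding vector_bundle_def by (elim conjE)
  from bspec[OF this assms]
  show "open U" "p \<in> U \<Longrightarrow> linear (\<tau> p)" "p \<in> U \<Longrightarrow> bij_betw (\<tau> p) UNIV (E p)" by auto
qed

lemma transition_smooth:
  assumes "(U, \<tau>) \<in> T" "(V, \<sigma>) \<in> T"
  shows "smooth_fun_on A (U \<inter> V) (\<lambda>p. inv (\<sigma> p) (\<tau> p x))"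
proof -
  have "\<forall>(U, \<tau>)\<in>T. \<forall>(V, \<sigma>)\<in>T. \<forall>x. smooth_fun_on A (U \<inter> V) (\<lambda>p. inv (\<sigma> p) (\<tau> p x))"
    using vector_bundle unfolding vector_bundle_def by (elim conjE)
  from bspec[OF this assms(1)] assms(2) show ?thesis by auto
qed

context
  fixes U \<tau> p
  assumes triv: "(U, \<tau>) \<in> T" and pU: "p \<in> U"
begin

lemma triv_in_E: "\<tau> p x \<in> E p"
  using trivializationD(3)[OF triv pU] by (auto simp: bij_betw_def)

lemma triv_inv: "inv (\<tau> p) (\<tau> p x) = x"
  using trivializationD(3)[OF triv pU] by (auto simp: bij_betw_def)

lemma inv_triv: "y \<in> E p \<Longrightarrow> \<tau> p (inv (\<tau> p) y) = y"
  using trivializationD(3)[OF triv pU] by (auto simp: bij_betw_def f_inv_into_f)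

text \<open>The image of \<open>\<tau> p\<close> is \<open>E p\<close> and not necessarily the whole
  type, so \<open>inv (\<tau> p)\<close> is controlled only on \<open>E p\<close>. This is the
  reason for the membership premises here and below.\<close>

lemma inv_triv_add: "x \<in> E p \<Longrightarrow> y \<in> E p \<Longrightarrow> inv (\<tau> p) (x + y) = inv (\<tau> p) x + inv (\<tau> p) y"
  using linear_add[OF trivializationD(2)[OF triv pU], of "inv (\<tau> p) x" "inv (\<tau> p) y"]
  by (metis inv_triv triv_inv)

lemma inv_triv_scale: "x \<in> E p \<Longrightarrow> inv (\<tau> p) (c *\<^sub>R x) = c *\<^sub>R inv (\<tau> p) x"
  using linear_scale[OF trivializationD(2)[OF triv pU], of c "inv (\<tau> p) x"]
  by (metis inv_triv triv_inv)

lemma inv_triv_0: "inv (\<tau> p) 0 = 0"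
  using linear_0[OF trivializationD(2)[OF triv pU]] triv_inv by metis

lemma inv_triv_eq_0: "y \<in> E p \<Longrightarrow> inv (\<tau> p) y = 0 \<Longrightarrow> y = 0"
  using linear_0[OF trivializationD(2)[OF triv pU]] inv_triv by metis

end

text \<open>Transition maps are assumed smooth only on constant vectors; expanding
  \<open>c p\<close> in \<open>B\<close> reduces a moving argument to that case.\<close>

lemma transition_smooth_fun:
  assumes T: "(U, \<tau>) \<in> T" "(V, \<sigma>) \<in> T" and W: "open W" "W \<subseteq> U \<inter> V" and c: "smooth_fun_on A W c"
  shows "smooth_fun_on A W (\<lambda>p. inv (\<sigma> p) (\<tau> p (c p)))"
proof (rule smooth_fun_on_cong[OF W(1)])
  show "smooth_fun_on A W (\<lambda>p. \<Sum>b\<in>B. (c p \<bullet> b) *\<^sub>R inv (\<sigma> p) (\<tau> p b))"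
    using smooth_fun_on_subset[OF transition_smooth[OF T] W(2)] c
    by (intro smooth_fun_on_sum smooth_fun_on_scaleR smooth_fun_on_inner smooth_fun_on_const W(1))
  fix p assume "p \<in> W"
  then have p: "p \<in> U" "p \<in> V" using W(2) by auto
  \<comment> \<open>As \<open>inv (\<sigma> p)\<close> is additive only on \<open>E p\<close>,
    linearity on sums is an induction that carries membership in \<open>E p\<close> along.\<close>
  have "inv (\<sigma> p) (\<Sum>b\<in>C. (c p \<bullet> b) *\<^sub>R \<tau> p b) = (\<Sum>b\<in>C. (c p \<bullet> b) *\<^sub>R inv (\<sigma> p) (\<tau> p b))"
    if "finite C" for C
    using that
  proof induction
    case empty
    show ?case by (simp add: inv_triv_0[OF T(2) p(2)])
  next
    case (insert b C)
    have "(\<Sum>b\<in>C. (c p \<bullet> b) *\<^sub>R \<tau> p b) \<in> E p"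
      by (intro E_closed triv_in_E[OF T(1) p(1)])
    with insert show ?case
      by (simp add: inv_triv_add[OF T(2) p(2)] inv_triv_scale[OF T(2) p(2)] triv_in_E[OF T(1) p(1)] E_closed)
  qed
  from this[OF finite_B]
  have "(\<Sum>b\<in>B. (c p \<bullet> b) *\<^sub>R inv (\<sigma> p) (\<tau> p b)) = inv (\<sigma> p) (\<Sum>b\<in>B. \<tau> p ((c p \<bullet> b) *\<^sub>R b))"
    by (simp add: linear_scale[OF trivializationD(2)[OF T(1) p(1)]])
  also have "\<dots> = inv (\<sigma> p) (\<tau> p (c p))"
    using linear_sum[OF trivializationD(2)[OF T(1) p(1)], of "\<lambda>b. (c p \<bullet> b) *\<^sub>R b" B] expand_B[of "c p"]
    by simp
  finally show "(\<Sum>b\<in>B. (c p \<bullet> b) *\<^sub>R inv (\<sigma> p) (\<tau> p b)) = inv (\<sigma> p) (\<tau> p (c p))" .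
qed

lemma section_in_E: "s \<in> sections A E T \<Longrightarrow> s p \<in> E p"
  by (simp add: sections_def)

lemma sectionI:
  "(\<And>p. s p \<in> E p) \<Longrightarrow> (\<And>U \<tau>. (U, \<tau>) \<in> T \<Longrightarrow> smooth_fun_on A U (\<lambda>p. inv (\<tau> p) (s p))) \<Longrightarrow>
    s \<in> sections A E T"
  by (auto simp: sections_def)

lemma section_smooth: "s \<in> sections A E T \<Longrightarrow> (U, \<tau>) \<in> T \<Longrightarrow> smooth_fun_on A U (\<lambda>p. inv (\<tau> p) (s p))"
  by (auto simp: sections_def)

text \<open>Transition maps preserve smoothness, so near each point a single trivialization is
  enough.\<close>

lemma section_local:
  assumes "\<And>p. s p \<in> E p"
    and "\<And>p. \<exists>U \<tau> N. (U, \<tau>) \<in> T \<and> open N \<and> p \<in> N \<and> N \<subseteq> U \<and> smooth_fun_on A N (\<lambda>q. inv (\<tau> q) (s q))"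
  shows "s \<in> sections A E T"
proof -
  have "smooth_fun_on A V (\<lambda>p. inv (\<sigma> p) (s p))" if V: "(V, \<sigma>) \<in> T" for V \<sigma>
  proof (rule smooth_fun_on_local)
    fix p assume "p \<in> V"
    obtain U \<tau> N where N: "(U, \<tau>) \<in> T" "open N" "p \<in> N" "N \<subseteq> U"
      "smooth_fun_on A N (\<lambda>q. inv (\<tau> q) (s q))"
      using assms(2)[of p] by blast
    have o: "open (N \<inter> V)" using N(2) trivializationD(1)[OF V] by blast
    have "smooth_fun_on A (N \<inter> V) (\<lambda>q. inv (\<sigma> q) (\<tau> q (inv (\<tau> q) (s q))))"
      by (rule transition_smooth_fun[OF N(1) V o])
         (use N(4) smooth_fun_on_subset[OF N(5)] in auto)
    then have "smooth_fun_on A (N \<inter> V) (\<lambda>q. inv (\<sigma> q) (s q))"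
      by (rule smooth_fun_on_cong[OF o, rotated])
         (use inv_triv[OF N(1) _ assms(1)] N(4) in auto)
    with o N(3) \<open>p \<in> V\<close> show "\<exists>N. open N \<and> p \<in> N \<and> smooth_fun_on A N (\<lambda>p. inv (\<sigma> p) (s p))"
      by blast
  qed
  with assms(1) show ?thesis by (rule sectionI)
qed

lemma section_add:
  assumes s: "s \<in> sections A E T" and t: "t \<in> sections A E T"
  shows "(\<lambda>q. s q + t q) \<in> sections A E T"
proof -
  have "smooth_fun_on A U (\<lambda>p. inv (\<tau> p) (s p + t p))" if U: "(U, \<tau>) \<in> T" for U \<tau>
    by (rule smooth_fun_on_cong[OF trivializationD(1)[OF U] _
          smooth_fun_on_add[OF trivializationD(1)[OF U] section_smooth[OF s U] section_smooth[OF t U]]])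
       (simp add: inv_triv_add[OF U] section_in_E s t)
  then show ?thesis by (rule sectionI[OF E_closed(1)[OF section_in_E[OF s] section_in_E[OF t]]])
qed

lemma section_scale:
  assumes f: "f \<in> smooth_funs A" and s: "s \<in> sections A E T"
  shows "(\<lambda>q. f q *\<^sub>R s q) \<in> sections A E T"
proof -
  have "smooth_fun_on A U (\<lambda>p. inv (\<tau> p) (f p *\<^sub>R s p))" if U: "(U, \<tau>) \<in> T" for U \<tau>
  proof -
    have "smooth_fun_on A U f" by (rule smooth_funs_restrict[OF f])
    from smooth_fun_on_scaleR[OF trivializationD(1)[OF U] this section_smooth[OF s U]]
    show ?thesis
      by (rule smooth_fun_on_cong[OF trivializationD(1)[OF U], rotated])
         (simp add: inv_triv_scale[OF U] section_in_E s)
  qed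
  then show ?thesis by (rule sectionI[OF E_closed(2)[OF section_in_E[OF s]]])
qed

lemma section_zero: "(\<lambda>q. 0) \<in> sections A E T"
proof -
  have "smooth_fun_on A U (\<lambda>p. inv (\<tau> p) 0)" if U: "(U, \<tau>) \<in> T" for U \<tau>
    by (rule smooth_fun_on_zero[OF trivializationD(1)[OF U]]) (rule inv_triv_0[OF U])
  then show ?thesis by (rule sectionI[OF E_closed(4)])
qed

lemma section_sum:
  "(\<And>i. i \<in> I \<Longrightarrow> s i \<in> sections A E T) \<Longrightarrow> (\<lambda>q. \<Sum>i\<in>I. s i q) \<in> sections A E T"
  by (induction I rule: infinite_finite_induct) (simp_all add: section_zero section_add)

lemma section_diff:
  assumes s: "s \<in> sections A E T" and t: "t \<in> sections A E T"
  shows "(\<lambda>q. s q - t q) \<in> sections A E T"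
  using section_add[OF s section_scale[OF smooth_funs_const[of "- 1"] t]] by simp

text \<open>A bump function extends the local section with constant coordinate \<open>x\<close> by
  zero; at p its factor is 1.\<close>

lemma section_through:
  assumes U: "(U, \<tau>) \<in> T" and p: "p \<in> U"
  obtains s where "s \<in> sections A E T" "s p = \<tau> p x"
proof -
  obtain \<rho> V Z where \<rho>: "\<rho> \<in> smooth_funs A" "p \<in> V" "\<And>q. q \<in> V \<Longrightarrow> \<rho> q = 1"
    "open Z" "U \<union> Z = UNIV" "\<And>q. q \<in> Z \<Longrightarrow> \<rho> q = 0"
    using bump_function_exists[OF trivializationD(1)[OF U] p] by metis
  define s where "s = (\<lambda>q. if q \<in> U then \<rho> q *\<^sub>R \<tau> q x else 0)"
  have "s \<in> sections A E T"
  proof (rule section_local)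
    show "s q \<in> E q" for q by (simp add: s_def E_closed triv_in_E[OF U])
    fix q
    show "\<exists>U \<tau> N. (U, \<tau>) \<in> T \<and> open N \<and> q \<in> N \<and> N \<subseteq> U \<and> smooth_fun_on A N (\<lambda>q. inv (\<tau> q) (s q))"
    proof (cases "q \<in> U")
      case True
      have "smooth_fun_on A U \<rho>" by (rule smooth_funs_restrict[OF \<rho>(1)])
      from smooth_fun_on_scaleR[OF trivializationD(1)[OF U] this smooth_fun_on_const[of U x]]
      have "smooth_fun_on A U (\<lambda>q. inv (\<tau> q) (s q))"
        by (rule smooth_fun_on_cong[OF trivializationD(1)[OF U], rotated])
           (simp add: s_def inv_triv_scale[OF U] triv_in_E[OF U] triv_inv[OF U])
      with True U trivializationD(1)[OF U] show ?thesis by blast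
    next
      case False
      then have "q \<in> Z" using \<rho>(5) by blast
      obtain W \<sigma> where W: "(W, \<sigma>) \<in> T" "q \<in> W" by (rule trivialization_at)
      have o: "open (W \<inter> Z)" using trivializationD(1)[OF W(1)] \<rho>(4) by blast
      have "smooth_fun_on A (W \<inter> Z) (\<lambda>q. inv (\<sigma> q) (s q))"
        by (rule smooth_fun_on_zero[OF o]) (simp add: s_def \<rho>(6) inv_triv_0[OF W(1)])
      with o W \<open>q \<in> Z\<close> show ?thesis by blast
    qed
  qed
  moreover have "s p = \<tau> p x" using p \<rho>(2,3) by (simp add: s_def)
  ultimately show thesis by (rule that)
qed

end

section \<open>A bundle metric\<close>

context smooth_manifold
begin

text \<open>If \<open>f k = 1\<close> on \<open>V k\<close>, the functions \<open>f k * (\<Prod>j<k. 1 - f j)\<close> with \<open>k > j\<close> vanish on \<open>V j\<close>.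
  This makes the family locally finite without any appeal to paracompactness.\<close>

lemma bump_cover:
  assumes "\<And>p. \<exists>U\<in>\<U>. open U \<and> p \<in> U"
  obtains U f V Z where "\<And>k::nat. U k \<in> \<U>" "\<And>k. f k \<in> smooth_funs A"
    "\<And>k q. 0 \<le> f k q \<and> f k q \<le> 1" "\<And>k. open (V k)" "\<And>k q. q \<in> V k \<Longrightarrow> f k q = 1"
    "(\<Union>k. V k) = UNIV" "\<And>k. open (Z k)" "\<And>k. U k \<union> Z k = UNIV" "\<And>k q. q \<in> Z k \<Longrightarrow> f k q = 0"
proof -
  define good where "good = (\<lambda>V (U, f, Z). U \<in> \<U> \<and> f \<in> smooth_funs A \<and>
    (\<forall>q. 0 \<le> f q \<and> f q \<le> 1) \<and> open V \<and> (\<forall>q\<in>V. f q = 1) \<and> open Z \<and> U \<union> Z = UNIV \<and>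
    (\<forall>q\<in>Z. f q = 0))"
  define \<V> where "\<V> = {V. \<exists>x. good V x}"
  have "\<exists>V\<in>\<V>. p \<in> V" for p
  proof -
    obtain U where U: "U \<in> \<U>" "open U" "p \<in> U" using assms by blast
    obtain \<rho> V Z where \<rho>: "\<rho> \<in> smooth_funs A" "\<And>q. 0 \<le> \<rho> q \<and> \<rho> q \<le> 1"
      "open V" "p \<in> V" "\<And>q. q \<in> V \<Longrightarrow> \<rho> q = 1"
      "open Z" "U \<union> Z = UNIV" "\<And>q. q \<in> Z \<Longrightarrow> \<rho> q = 0"
      using bump_function_exists[OF U(2,3)] by metis
    then have "good V (U, \<rho>, Z)" using U by (simp add: good_def)
    then have "V \<in> \<V>" unfolding \<V>_def by blast
    with \<rho>(4) show ?thesis by blast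
  qed
  then have cover: "\<Union>\<V> = UNIV" by blast
  have "open V" if V: "V \<in> \<V>" for V
  proof -
    obtain U f Z where "good V (U, f, Z)" using V unfolding \<V>_def by auto
    then show ?thesis by (simp add: good_def)
  qed
  \<comment> \<open>Second countability enters here: countably many of the sets on which a bump
    function equals 1 already cover the manifold.\<close>
  then obtain \<W> where W: "\<W> \<subseteq> \<V>" "countable \<W>" "\<Union>\<W> = UNIV"
    using Lindelof[of \<V>] cover by metis
  then have "\<W> \<noteq> {}" by auto
  define V where "V = from_nat_into \<W>"
  have rV: "range V = \<W>" unfolding V_def by (rule range_from_nat_into[OF \<open>\<W> \<noteq> {}\<close> W(2)])
  have "\<exists>U f Z. good (V k) (U, f, Z)" for k
  proof -
    have "V k \<in> \<V>" using rV W(1) by blast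
    then show ?thesis unfolding \<V>_def by auto
  qed
  then obtain U f Z where g: "\<And>k. good (V k) (U k, f k, Z k)" by metis
  show thesis
    by (rule that[of U f V Z]) (use g rV W(3) in \<open>auto simp: good_def\<close>)
qed

end

context smooth_vector_bundle
begin

definition bundle_metric :: "('m \<Rightarrow> 'v \<Rightarrow> 'v \<Rightarrow> real) \<Rightarrow> bool"
  where "bundle_metric G \<longleftrightarrow>
    (\<forall>p. \<forall>x\<in>E p. \<forall>y\<in>E p. G p x y = G p y x) \<and>
    (\<forall>p. \<forall>x\<in>E p. \<forall>y\<in>E p. \<forall>z\<in>E p. G p (x + y) z = G p x z + G p y z) \<and>
    (\<forall>p c. \<forall>x\<in>E p. \<forall>y\<in>E p. G p (c *\<^sub>R x) y = c * G p x y) \<and>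
    (\<forall>p. \<forall>x\<in>E p. x \<noteq> 0 \<longrightarrow> G p x x > 0) \<and>
    (\<forall>s\<in>sections A E T. \<forall>t\<in>sections A E T. (\<lambda>p. G p (s p) (t p)) \<in> smooth_funs A)"

text \<open>A combination with nonnegative weights of inner products pulled back along
  trivializations is positive definite wherever one weight is positive.\<close>

lemma bundle_metric_exists: "\<exists>G. bundle_metric G"
proof -
  have "\<exists>U\<in>fst ` T. open U \<and> p \<in> U" for p
  proof -
    obtain U \<tau> where "(U, \<tau>) \<in> T" "p \<in> U" by (rule trivialization_at)
    then show ?thesis using trivializationD(1) by force
  qed
  then obtain U f V Z where UT: "\<And>k::nat. U k \<in> fst ` T" and f: "\<And>k. f k \<in> smooth_funs A"
    and f01: "\<And>k q. 0 \<le> f k q \<and> f k q \<le> 1" and V: "\<And>k. open (V k)"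
    and f1: "\<And>k q. q \<in> V k \<Longrightarrow> f k q = 1" and cover: "(\<Union>k. V k) = UNIV"
    and Z: "\<And>k. open (Z k)" "\<And>k. U k \<union> Z k = UNIV" and f0: "\<And>k q. q \<in> Z k \<Longrightarrow> f k q = 0"
    by (rule bump_cover[of "fst ` T"]) blast
  have "\<exists>\<tau>. (U k, \<tau>) \<in> T" for k using UT[of k] by auto
  then obtain \<tau> where T: "\<And>k. (U k, \<tau> k) \<in> T" by metis
  define \<psi> where "\<psi> = (\<lambda>k q. f k q * (\<Prod>j<k. 1 - f j q))"
  define g where "g = (\<lambda>k q x y. inv (\<tau> k q) x \<bullet> inv (\<tau> k q) y)"
  \<comment> \<open>The cut \<open>m q\<close> depends on \<open>q\<close>, but on
    \<open>V j\<close> the sum up to \<open>j\<close> has the same value, so \<open>G\<close> is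
    locally a fixed finite sum and hence smooth.\<close>
  define m where "m = (\<lambda>q. LEAST j. q \<in> V j)"
  define G where "G = (\<lambda>q x y. \<Sum>k\<le>m q. \<psi> k q * g k q x y)"
  have \<psi>_nonneg: "\<psi> k q \<ge> 0" for k q
    unfolding \<psi>_def using f01 by (intro mult_nonneg_nonneg prod_nonneg) auto
  have \<psi>_vanish: "\<psi> k q = 0" if "q \<in> V j" "j < k" for k j q
  proof -
    have "(\<Prod>j<k. 1 - f j q) = 0" using f1[OF that(1)] that(2) by (intro prod_zero) auto
    then show ?thesis by (simp add: \<psi>_def)
  qed
  \<comment> \<open>Off \<open>U k\<close> nothing is known about \<open>\<tau> k q\<close>, hence
    about \<open>g k q\<close>; the weight 0 removes this term.\<close>
  have \<psi>_outside: "\<psi> k q = 0" if "q \<notin> U k" for k q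
  proof -
    have "q \<in> Z k" using Z(2)[of k] that by blast
    then show ?thesis by (simp add: \<psi>_def f0)
  qed
  have \<psi>_smooth: "\<psi> k \<in> smooth_funs A" for k
    unfolding \<psi>_def smooth_funs_iff
    by (intro smooth_fun_on_mult smooth_fun_on_prod smooth_fun_on_diff smooth_fun_on_const open_UNIV
        smooth_funs_restrict[OF f])
  have mV: "q \<in> V (m q)" for q
  proof -
    have "\<exists>j. q \<in> V j" using cover by blast
    then show ?thesis unfolding m_def by (rule LeastI_ex)
  qed
  have G_eq: "G q x y = (\<Sum>k\<le>j. \<psi> k q * g k q x y)" if "q \<in> V j" for q j x y
  proof -
    have "m q \<le> j" unfolding m_def using that by (rule Least_le)
    then show ?thesis
      unfolding G_def by (intro sum.mono_neutral_left) (auto simp: \<psi>_vanish[OF mV])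
  qed
  have sym: "G p x y = G p y x" for p x y
    by (simp add: G_def g_def inner_commute)
  have add: "G p (x + y) z = G p x z + G p y z" if "x \<in> E p" "y \<in> E p" for p x y z
  proof -
    have "\<psi> k p * g k p (x + y) z = \<psi> k p * g k p x z + \<psi> k p * g k p y z" for k
      by (cases "p \<in> U k")
         (simp_all add: \<psi>_outside g_def inv_triv_add[OF T _ that] inner_add_left distrib_left)
    then show ?thesis by (simp add: G_def sum.distrib)
  qed
  have scale: "G p (c *\<^sub>R x) y = c * G p x y" if "x \<in> E p" for p c x y
  proof -
    have "\<psi> k p * g k p (c *\<^sub>R x) y = c * (\<psi> k p * g k p x y)" for k
      by (cases "p \<in> U k") (simp_all add: \<psi>_outside g_def inv_triv_scale[OF T _ that])
    then show ?thesis unfolding G_def sum_distrib_left by (intro sum.cong refl)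
  qed
  have pos: "G p x x > 0" if x: "x \<in> E p" "x \<noteq> 0" for p x
  proof -
    \<comment> \<open>At the first bump function that is nonzero at p, all earlier factors 1 - f j p
      equal 1, so the weight is \<open>f k p > 0\<close>.\<close>
    define k where "k = (LEAST k. f k p \<noteq> 0)"
    have fm: "f (m p) p \<noteq> 0" using f1[OF mV[of p]] by simp
    have km: "k \<le> m p" unfolding k_def by (rule Least_le[of "\<lambda>k. f k p \<noteq> 0", OF fm])
    have fk: "f k p \<noteq> 0" unfolding k_def by (rule LeastI[of "\<lambda>k. f k p \<noteq> 0", OF fm])
    have "f j p = 0" if "j < k" for j using that not_less_Least unfolding k_def by blast
    then have "\<psi> k p = f k p" by (simp add: \<psi>_def)
    then have \<psi>k: "\<psi> k p > 0" using fk f01[of k p] by linarith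
    then have "p \<in> U k" using \<psi>_outside[of p k] by force
    then have "g k p x x > 0"
      using inv_triv_eq_0[OF T _ x(1)] x(2) by (auto simp: g_def)
    then have "0 < \<psi> k p * g k p x x" using \<psi>k by simp
    also have "\<dots> \<le> G p x x"
      unfolding G_def by (rule member_le_sum) (use km \<psi>_nonneg in \<open>auto simp: g_def\<close>)
    finally show ?thesis .
  qed
  have term_smooth: "(\<lambda>p. \<psi> k p * g k p (s p) (t p)) \<in> smooth_funs A"
    if s: "s \<in> sections A E T" and t: "t \<in> sections A E T" for s t k
    unfolding smooth_funs_iff
  proof (rule smooth_fun_on_union)
    show "open (U k)" using trivializationD(1)[OF T] .
    show "smooth_fun_on A (U k) (\<lambda>p. \<psi> k p * g k p (s p) (t p))"
      unfolding g_def
      by (intro smooth_fun_on_mult smooth_fun_on_inner smooth_funs_restrict[OF \<psi>_smooth]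
          section_smooth[OF s T] section_smooth[OF t T] \<open>open (U k)\<close>)
    show "open (Z k)" by (rule Z)
    show "smooth_fun_on A (Z k) (\<lambda>p. \<psi> k p * g k p (s p) (t p))"
      by (rule smooth_fun_on_zero[OF Z(1)]) (simp add: \<psi>_def f0)
    show "UNIV \<subseteq> U k \<union> Z k" using Z(2) by simp
  qed
  have smooth: "(\<lambda>p. G p (s p) (t p)) \<in> smooth_funs A"
    if s: "s \<in> sections A E T" and t: "t \<in> sections A E T" for s t
  proof (rule smooth_funs_local)
    fix p
    have "(\<lambda>q. \<Sum>k\<le>m p. \<psi> k q * g k q (s q) (t q)) \<in> smooth_funs A"
      by (rule smooth_funs_sum) (rule term_smooth[OF s t])
    with V mV G_eq show "\<exists>N h. open N \<and> p \<in> N \<and> (\<forall>q\<in>N. G q (s q) (t q) = h q) \<and> h \<in> smooth_funs A"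
      by (intro exI[of _ "V (m p)"] exI[of _ "\<lambda>q. \<Sum>k\<le>m p. \<psi> k q * g k q (s q) (t q)"]) auto
  qed
  have "bundle_metric G"
    unfolding bundle_metric_def
    by (intro conjI allI ballI impI)
       (rule sym | erule (1) add | erule scale | erule (1) pos | erule (1) smooth)+
  then show ?thesis by (rule exI[of bundle_metric G])
qed

end

section \<open>Orthonormal frames\<close>

locale metric_bundle = smooth_vector_bundle A E T B
  for A :: "('m::{t2_space, second_countable_topology}, 'e::{real_inner, heine_borel}) chart set"
    and E :: "'m \<Rightarrow> 'v::real_vector set"
    and T :: "('m, 'v, 'f::{real_inner, heine_borel}) trivialization set"
    and B :: "'f set" +
  fixes G :: "'m \<Rightarrow> 'v \<Rightarrow> 'v \<Rightarrow> real"
  assumes metric: "bundle_metric G"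
begin

lemma G_sym: "x \<in> E p \<Longrightarrow> y \<in> E p \<Longrightarrow> G p x y = G p y x"
  using metric unfolding bundle_metric_def by blast

lemma G_add: "x \<in> E p \<Longrightarrow> y \<in> E p \<Longrightarrow> z \<in> E p \<Longrightarrow> G p (x + y) z = G p x z + G p y z"
  using metric unfolding bundle_metric_def by blast

lemma G_scale: "x \<in> E p \<Longrightarrow> y \<in> E p \<Longrightarrow> G p (c *\<^sub>R x) y = c * G p x y"
  using metric unfolding bundle_metric_def by blast

lemma G_pos: "x \<in> E p \<Longrightarrow> x \<noteq> 0 \<Longrightarrow> G p x x > 0"
  using metric unfolding bundle_metric_def by blast

lemma G_smooth: "s \<in> sections A E T \<Longrightarrow> t \<in> sections A E T \<Longrightarrow> (\<lambda>p. G p (s p) (t p)) \<in> smooth_funs A"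
  using metric unfolding bundle_metric_def by blast

lemma G_zero: "y \<in> E p \<Longrightarrow> G p 0 y = 0"
  using G_scale[of 0 p y 0] E_closed(4) by simp

lemma G_diff: "x \<in> E p \<Longrightarrow> y \<in> E p \<Longrightarrow> z \<in> E p \<Longrightarrow> G p (x - y) z = G p x z - G p y z"
  using G_add[of "x - y" p y z] E_closed(3)[of x p y] by simp

lemma G_sum:
  assumes "\<And>i. i \<in> I \<Longrightarrow> x i \<in> E p" and y: "y \<in> E p"
  shows "G p (\<Sum>i\<in>I. x i) y = (\<Sum>i\<in>I. G p (x i) y)"
  using assms(1)
proof (induction I rule: infinite_finite_induct)
  case (insert i I)
  have "(\<Sum>i\<in>I. x i) \<in> E p" by (rule E_closed(5)) (rule insert.prems, simp)
  moreover have "x i \<in> E p" using insert.prems by simp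
  ultimately show ?case using insert by (simp add: G_add[OF _ _ y])
qed (simp_all add: G_zero y)

lemma G_lincomb:
  assumes "\<And>i. i \<in> I \<Longrightarrow> x i \<in> E p" and y: "y \<in> E p"
  shows "G p (\<Sum>i\<in>I. c i *\<^sub>R x i) y = (\<Sum>i\<in>I. c i * G p (x i) y)"
proof -
  have "G p (\<Sum>i\<in>I. c i *\<^sub>R x i) y = (\<Sum>i\<in>I. G p (c i *\<^sub>R x i) y)"
    by (rule G_sum[OF E_closed(2)[OF assms(1)] y])
  also have "\<dots> = (\<Sum>i\<in>I. c i * G p (x i) y)"
    by (rule sum.cong[OF refl]) (rule G_scale[OF assms(1) y])
  finally show ?thesis .
qed

definition orthonormal :: "'m \<Rightarrow> 'f set \<Rightarrow> ('f \<Rightarrow> 'v) \<Rightarrow> bool"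
  where "orthonormal p C e \<longleftrightarrow>
    (\<forall>b\<in>C. e b \<in> E p) \<and> (\<forall>b\<in>C. \<forall>c\<in>C. G p (e b) (e c) = (if b = c then 1 else 0))"

lemma orthonormal_coeff:
  assumes "orthonormal p C e" "finite C" "c \<in> C"
  shows "G p (\<Sum>b\<in>C. k b *\<^sub>R e b) (e c) = k c"
proof -
  have "G p (\<Sum>b\<in>C. k b *\<^sub>R e b) (e c) = (\<Sum>b\<in>C. k b * G p (e b) (e c))"
    by (rule G_lincomb) (use assms in \<open>auto simp: orthonormal_def\<close>)
  also have "\<dots> = (\<Sum>b\<in>C. if b = c then k c else 0)"
    by (rule sum.cong) (use assms in \<open>auto simp: orthonormal_def\<close>)
  also have "\<dots> = k c" using assms by simp
  finally show ?thesis .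
qed

text \<open>A nonzero residual orthogonal to all \<open>e b\<close> would give
  \<open>card B + 1\<close> independent vectors in the span of the vectors \<open>\<tau> p b\<close>
  with \<open>b\<close> in \<open>B\<close>.\<close>

lemma orthonormal_expand:
  assumes e: "orthonormal p B e" and x: "x \<in> E p"
  shows "x = (\<Sum>b\<in>B. G p x (e b) *\<^sub>R e b)"
proof (rule ccontr)
  define y where "y = x - (\<Sum>b\<in>B. G p x (e b) *\<^sub>R e b)"
  assume "x \<noteq> (\<Sum>b\<in>B. G p x (e b) *\<^sub>R e b)"
  then have "y \<noteq> 0" by (simp add: y_def)
  have eE: "e b \<in> E p" if "b \<in> B" for b using e that by (simp add: orthonormal_def)
  have sE: "(\<Sum>b\<in>B. G p x (e b) *\<^sub>R e b) \<in> E p" by (rule E_closed(5)[OF E_closed(2)[OF eE]])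
  have yE: "y \<in> E p" unfolding y_def by (rule E_closed(3)[OF x sE])
  have ye: "G p y (e c) = 0" if "c \<in> B" for c
    using G_diff[OF x sE eE[OF that]] orthonormal_coeff[OF e finite_B that] by (simp add: y_def)
  have inj: "inj_on e B"
  proof (rule inj_onI, rule ccontr)
    fix b c assume bc: "b \<in> B" "c \<in> B" "e b = e c" "b \<noteq> c"
    then have "G p (e b) (e c) = 0" "G p (e b) (e b) = 1"
      using e unfolding orthonormal_def by metis+
    with bc(3) show False by simp
  qed
  have y_notin: "y \<notin> e ` B"
  proof
    assume "y \<in> e ` B"
    then obtain c where "c \<in> B" "y = e c" by blast
    then show False using ye G_pos[OF yE \<open>y \<noteq> 0\<close>] by simp
  qed
  have "independent (insert y (e ` B))"
    unfolding independent_explicit_finite_subsets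
  proof (intro allI impI ballI)
    fix S u v
    assume S: "S \<subseteq> insert y (e ` B)" "finite S" and 0: "(\<Sum>v\<in>S. u v *\<^sub>R v) = 0" and v: "v \<in> S"
    have SE: "w \<in> E p" if "w \<in> S" for w using that S(1) yE eE by blast
    have ortho: "G p w v = 0" if "w \<in> S" "w \<noteq> v" for w
    proof -
      have "w = y \<or> (\<exists>b\<in>B. w = e b)" "v = y \<or> (\<exists>b\<in>B. v = e b)" using that v S(1) by blast+
      moreover have "G p (e b) y = 0" if "b \<in> B" for b
        using ye[OF that] G_sym[OF yE eE[OF that]] by simp
      moreover have "G p (e b) (e c) = 0" if "b \<in> B" "c \<in> B" "e b \<noteq> e c" for b c
        using e that by (auto simp: orthonormal_def)
      ultimately show ?thesis using ye that(2) by blast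
    qed
    have "v \<noteq> 0"
    proof
      assume "v = 0"
      then obtain b where b: "b \<in> B" "e b = 0" using v S(1) \<open>y \<noteq> 0\<close> by auto
      have "G p (e b) (e b) = 1" using e b(1) by (simp add: orthonormal_def)
      with b(2) show False using G_zero[OF E_closed(4)] by simp
    qed
    have "0 = G p (\<Sum>w\<in>S. u w *\<^sub>R w) v" using 0 G_zero[OF SE[OF v]] by simp
    also have "\<dots> = (\<Sum>w\<in>S. u w * G p w v)" by (rule G_lincomb[OF _ SE[OF v]]) (rule SE)
    also have "\<dots> = (\<Sum>w\<in>S. if w = v then u v * G p v v else 0)"
      by (rule sum.cong) (auto simp: ortho)
    also have "\<dots> = u v * G p v v" using S(2) v by simp
    finally show "u v = 0" using G_pos[OF SE[OF v] \<open>v \<noteq> 0\<close>] by simp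
  qed
  moreover obtain U \<tau> where U: "(U, \<tau>) \<in> T" "p \<in> U" by (rule trivialization_at)
  have "insert y (e ` B) \<subseteq> span (\<tau> p ` B)"
  proof
    fix z assume "z \<in> insert y (e ` B)"
    then have "z \<in> E p" using yE eE by blast
    then have "z = \<tau> p (\<Sum>b\<in>B. (inv (\<tau> p) z \<bullet> b) *\<^sub>R b)"
      using inv_triv[OF U] expand_B[of "inv (\<tau> p) z"] by simp
    also have "\<dots> = (\<Sum>b\<in>B. (inv (\<tau> p) z \<bullet> b) *\<^sub>R \<tau> p b)"
      by (simp add: linear_sum[OF trivializationD(2)[OF U]] linear_scale[OF trivializationD(2)[OF U]])
    also have "\<dots> \<in> span (\<tau> p ` B)"
      by (intro span_sum span_scale span_base imageI)
    finally show "z \<in> span (\<tau> p ` B)" .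
  qed
  ultimately have "card (insert y (e ` B)) \<le> card (\<tau> p ` B)"
    using independent_span_bound[of "\<tau> p ` B"] finite_B by blast
  also have "\<dots> \<le> card B" by (rule card_image_le[OF finite_B])
  finally show False using y_notin finite_B by (simp add: card_image[OF inj])
qed

text \<open>The span condition at p is the invariant that keeps the process going: the next vector
  \<open>\<tau> p c\<close> lies outside \<open>\<tau> p\<close> applied to \<open>span C\<close>,
  so its residual is nonzero at p and, by continuity of its squared length, near p. Each step may
  shrink the neighbourhood.\<close>

lemma gram_schmidt:
  assumes U: "(U, \<tau>) \<in> T" "p \<in> U" and C: "C \<subseteq> B"
  shows "\<exists>s N. (\<forall>b\<in>C. s b \<in> sections A E T \<and> s b p \<in> \<tau> p ` span C) \<and> open N \<and> p \<in> N \<and>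
    (\<forall>q\<in>N. orthonormal q C (\<lambda>b. s b q))"
proof -
  have "finite C" using C finite_B by (rule finite_subset)
  then show ?thesis using C
  proof (induction C)
    case empty
    show ?case by (intro exI[of _ "\<lambda>b q. 0"] exI[of _ UNIV]) (simp add: orthonormal_def)
  next
    case (insert c C)
    then have "C \<subseteq> B" by simp
    from insert.IH[OF this] obtain s N where s: "\<And>b. b \<in> C \<Longrightarrow> s b \<in> sections A E T"
      and span: "\<And>b. b \<in> C \<Longrightarrow> s b p \<in> \<tau> p ` span C"
      and N: "open N" "p \<in> N" and on: "\<And>q. q \<in> N \<Longrightarrow> orthonormal q C (\<lambda>b. s b q)" by metis
    have lin: "linear (\<tau> p)" by (rule trivializationD(2)[OF U])
    have sub: "subspace (\<tau> p ` span D)" for D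
      by (rule linear_subspace_image[OF lin subspace_span])
    obtain \<sigma> where \<sigma>: "\<sigma> \<in> sections A E T" "\<sigma> p = \<tau> p c" by (rule section_through[OF U])
    define t where "t = (\<lambda>q. \<sigma> q - (\<Sum>b\<in>C. G q (\<sigma> q) (s b q) *\<^sub>R s b q))"
    have proj: "(\<lambda>q. \<Sum>b\<in>C. G q (\<sigma> q) (s b q) *\<^sub>R s b q) \<in> sections A E T"
      by (rule section_sum, rule section_scale[OF G_smooth[OF \<sigma>(1) s] s])
    have t: "t \<in> sections A E T"
      unfolding t_def by (rule section_diff[OF \<sigma>(1) proj])
    have proj_span: "(\<Sum>b\<in>C. G p (\<sigma> p) (s b p) *\<^sub>R s b p) \<in> \<tau> p ` span C"
      by (rule subspace_sum[OF sub subspace_scale[OF sub span]])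
    have "t p \<noteq> 0"
    proof
      assume "t p = 0"
      then have "\<tau> p c \<in> \<tau> p ` span C" using proj_span \<sigma>(2) by (simp add: t_def)
      then obtain x where "x \<in> span C" "\<tau> p c = \<tau> p x" by blast
      then have c: "c \<in> span C" using triv_inv[OF U] by metis
      \<comment> \<open>Orthonormality of \<open>B\<close> makes \<open>c\<close> orthogonal to
        \<open>span C\<close>, so membership would give c \<bullet> c = 0 instead of 1.\<close>
      have "c \<bullet> x = 0" if "x \<in> span C" for x
        using that
      proof (induction rule: span_induct_alt)
        case (step k b x)
        have "c \<bullet> b = 0" using orthonormal_B[of c b] insert step.hyps by auto
        with step show ?case by (simp add: inner_add_right)
      qed simp
      from this[OF c] show False using orthonormal_B[of c c] insert.prems by simp
    qed
    have tE: "t q \<in> E q" for q by (rule section_in_E[OF t])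
    have ts: "G q (t q) (s b q) = 0" if "q \<in> N" "b \<in> C" for q b
      using orthonormal_coeff[OF on[OF that(1)] insert.hyps(1) that(2)]
        G_diff[OF section_in_E[OF \<sigma>(1)] section_in_E[OF proj] section_in_E[OF s[OF that(2)]], of q]
      by (simp add: t_def)
    define h where "h = (\<lambda>q. G q (t q) (t q))"
    have h: "h \<in> smooth_funs A" unfolding h_def by (rule G_smooth[OF t t])
    have hp: "h p > 0" unfolding h_def by (rule G_pos[OF tE \<open>t p \<noteq> 0\<close>])
    define P where "P = {q. h q > 0}"
    have oP: "open P"
      unfolding P_def by (rule open_Collect_less[OF continuous_on_const smooth_fun_continuous[OF h]])
    have pP: "p \<in> P" using hp by (simp add: P_def)
    obtain \<rho> V Z where \<rho>: "\<rho> \<in> smooth_funs A" "open V" "p \<in> V" "\<And>q. q \<in> V \<Longrightarrow> \<rho> q = 1"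
      "open Z" "P \<union> Z = UNIV" "\<And>q. q \<in> Z \<Longrightarrow> \<rho> q = 0"
      using bump_function_exists[OF oP pP] by metis
    \<comment> \<open>Division by the length of \<open>t\<close> makes sense where h > 0; the bump
      function, equal to 1 near p, makes the factor globally smooth.\<close>
    define r where "r = (\<lambda>q. \<rho> q * h q powr (- 1 / 2))"
    have r: "r \<in> smooth_funs A"
      unfolding smooth_funs_iff
    proof (rule smooth_fun_on_union[OF oP _ \<rho>(5)])
      have "smooth_fun_on A P (\<lambda>q. h q powr (- 1 / 2))"
        by (rule smooth_fun_on_compose_real[OF oP open_greaterThan _ C_diff_powr smooth_funs_restrict[OF h]])
           (auto simp: P_def)
      then show "smooth_fun_on A P r"
        unfolding r_def by (rule smooth_fun_on_mult[OF oP smooth_funs_restrict[OF \<rho>(1)]])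
      show "smooth_fun_on A Z r" by (rule smooth_fun_on_zero[OF \<rho>(5)]) (simp add: r_def \<rho>(7))
      show "UNIV \<subseteq> P \<union> Z" using \<rho>(6) by simp
    qed
    define u where "u = (\<lambda>q. r q *\<^sub>R t q)"
    have u: "u \<in> sections A E T" unfolding u_def by (rule section_scale[OF r t])
    have uE: "u q \<in> E q" for q by (rule section_in_E[OF u])
    have us: "G q (u q) (s b q) = 0" if "q \<in> N" "b \<in> C" for q b
      using ts[OF that] G_scale[OF tE section_in_E[OF s[OF that(2)]], of q] by (simp add: u_def)
    have uu: "G q (u q) (u q) = 1" if "q \<in> P \<inter> V" for q
    proof -
      have hq: "h q > 0" "\<rho> q = 1" using that \<rho>(4) by (auto simp: P_def)
      have "G q (u q) (u q) = r q * G q (u q) (t q)"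
        using G_scale[OF tE uE] G_sym[OF tE uE] by (simp add: u_def)
      also have "\<dots> = r q * (r q * h q)"
        using G_scale[OF tE tE] by (simp add: u_def h_def)
      also have "\<dots> = (h q powr (- 1 / 2) * h q powr (- 1 / 2)) * h q" using hq by (simp add: r_def)
      also have "\<dots> = 1" using hq by (simp flip: powr_add)
      finally show ?thesis .
    qed
    define s' where "s' = s(c := u)"
    have s': "s' c = u" "\<And>b. b \<in> C \<Longrightarrow> s' b = s b"
      using insert.hyps(2) by (auto simp: s'_def)
    have mono: "\<tau> p ` span C \<subseteq> \<tau> p ` span (insert c C)"
      by (intro image_mono span_mono) auto
    have "u p \<in> \<tau> p ` span (insert c C)"
      unfolding u_def t_def \<sigma>(2)
      by (intro subspace_scale[OF sub] subspace_diff[OF sub] imageI span_base insertI1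
          subsetD[OF mono proj_span[unfolded \<sigma>(2)]])
    then have 1: "\<forall>b\<in>insert c C. s' b \<in> sections A E T \<and> s' b p \<in> \<tau> p ` span (insert c C)"
      using s u span mono s' by auto
    have "orthonormal q (insert c C) (\<lambda>b. s' b q)" if q: "q \<in> N \<inter> (P \<inter> V)" for q
    proof -
      have qN: "q \<in> N" using q by simp
      have su: "G q (s b q) (u q) = 0" if "b \<in> C" for b
        using us[OF qN that] G_sym[OF uE section_in_E[OF s[OF that]]] by simp
      have uuq: "G q (u q) (u q) = 1" using uu q by blast
      show ?thesis
        using on[OF qN] insert.hyps(2) us[OF qN] su uuq uE
        by (auto simp: orthonormal_def s')
    qed
    moreover have "open (N \<inter> (P \<inter> V))" "p \<in> N \<inter> (P \<inter> V)"
      using N oP pP \<rho>(2,3) by auto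
    ultimately show ?case using 1 by (intro exI[of _ s'] exI[of _ "N \<inter> (P \<inter> V)"]) blast
  qed
qed

text \<open>The members are global sections, so their inner products are global smooth functions to
  which derivations apply; over points outside \<open>N\<close> they may be dependent or
  zero.\<close>

definition frame_on :: "'m set \<Rightarrow> ('f \<Rightarrow> 'm \<Rightarrow> 'v) \<Rightarrow> bool"
  where "frame_on N s \<longleftrightarrow> (\<forall>b\<in>B. s b \<in> sections A E T) \<and> (\<forall>q\<in>N. orthonormal q B (\<lambda>b. s b q))"

lemma frame_exists: "\<exists>s N. open N \<and> p \<in> N \<and> frame_on N s"
proof -
  obtain U \<tau> where U: "(U, \<tau>) \<in> T" "p \<in> U" by (rule trivialization_at)
  from gram_schmidt[OF U order_refl] show ?thesis unfolding frame_on_def by blast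
qed

end

section \<open>Connections\<close>

locale metric_bundle_connection = metric_bundle A E T B G
  for A :: "('m::{t2_space, second_countable_topology}, 'e::{real_inner, heine_borel}) chart set"
    and E :: "'m \<Rightarrow> 'v::real_vector set"
    and T :: "('m, 'v, 'f::{real_inner, heine_borel}) trivialization set"
    and B :: "'f set"
    and G :: "'m \<Rightarrow> 'v \<Rightarrow> 'v \<Rightarrow> real" +
  fixes nabla :: "('m, 'v) conn"
  assumes conn: "connection A E T nabla"
begin

lemma nabla_form: "s \<in> sections A E T \<Longrightarrow> bundle_one_form A E T (nabla s)"
  using conn by (simp add: connection_def)

lemma nabla_linear: "s \<in> sections A E T \<Longrightarrow> linear_on_tangent A p (nabla s p)"
  using nabla_form by (simp add: bundle_one_form_def)

lemma nabla_in_E: "s \<in> sections A E T \<Longrightarrow> v \<in> tangent_space A p \<Longrightarrow> nabla s p v \<in> E p"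
  using nabla_form by (simp add: bundle_one_form_def)

lemma nabla_section:
  "s \<in> sections A E T \<Longrightarrow> X \<in> vector_fields A \<Longrightarrow> (\<lambda>p. nabla s p (X p)) \<in> sections A E T"
  using nabla_form by (simp add: bundle_one_form_def)

lemma nabla_add:
  assumes "s \<in> sections A E T" "t \<in> sections A E T" "v \<in> tangent_space A p"
  shows "nabla (\<lambda>q. s q + t q) p v = nabla s p v + nabla t p v"
  using conn assms by (simp add: connection_def)

lemma nabla_scale:
  assumes "f \<in> smooth_funs A" "s \<in> sections A E T" "v \<in> tangent_space A p"
  shows "nabla (\<lambda>q. f q *\<^sub>R s q) p v = v f *\<^sub>R s p + f p *\<^sub>R nabla s p v"
  using conn assms by (simp add: connection_def)

lemma nabla_zero:
  assumes v: "v \<in> tangent_space A p"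
  shows "nabla (\<lambda>q. 0) p v = 0"
  using nabla_scale[OF smooth_funs_const[of 0] section_zero v] tangent_const[OF v] by simp

lemma nabla_diff:
  assumes s: "s \<in> sections A E T" and t: "t \<in> sections A E T" and v: "v \<in> tangent_space A p"
  shows "nabla (\<lambda>q. s q - t q) p v = nabla s p v - nabla t p v"
  using nabla_add[OF section_diff[OF s t] t v] by simp

lemma nabla_sum:
  assumes s: "\<And>i. i \<in> I \<Longrightarrow> s i \<in> sections A E T" and v: "v \<in> tangent_space A p"
  shows "nabla (\<lambda>q. \<Sum>i\<in>I. s i q) p v = (\<Sum>i\<in>I. nabla (s i) p v)"
  using s
proof (induction I rule: infinite_finite_induct)
  case (insert i I)
  have "(\<lambda>q. \<Sum>i\<in>I. s i q) \<in> sections A E T" by (rule section_sum) (rule insert.prems, simp)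
  moreover have "s i \<in> sections A E T" using insert.prems by simp
  ultimately show ?case using insert nabla_add[OF _ _ v] by simp
qed (simp_all add: nabla_zero[OF v])

text \<open>A bump function times the difference is the zero section. By the Leibniz rule at p,
  where the bump function is 1 and the difference 0, its derivative is also that of the
  difference.\<close>

lemma nabla_local:
  assumes s: "s \<in> sections A E T" and t: "t \<in> sections A E T" and v: "v \<in> tangent_space A p"
    and N: "open N" "p \<in> N" and eq: "\<And>q. q \<in> N \<Longrightarrow> s q = t q"
  shows "nabla s p v = nabla t p v"
proof -
  obtain \<rho> V Z where \<rho>: "\<rho> \<in> smooth_funs A" "p \<in> V" "\<And>q. q \<in> V \<Longrightarrow> \<rho> q = 1"
    "N \<union> Z = UNIV" "\<And>q. q \<in> Z \<Longrightarrow> \<rho> q = 0"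
    using bump_function_exists[OF N] by metis
  have "(\<lambda>q. \<rho> q *\<^sub>R (s q - t q)) = (\<lambda>q. 0)"
  proof
    fix q
    have "q \<in> N \<or> q \<in> Z" using \<rho>(4) by blast
    then show "\<rho> q *\<^sub>R (s q - t q) = 0" using eq[of q] \<rho>(5)[of q] by auto
  qed
  then have "nabla (\<lambda>q. \<rho> q *\<^sub>R (s q - t q)) p v = 0"
    using nabla_zero[OF v] by simp
  moreover have "nabla (\<lambda>q. \<rho> q *\<^sub>R (s q - t q)) p v = nabla s p v - nabla t p v"
    using nabla_scale[OF \<rho>(1) section_diff[OF s t] v] nabla_diff[OF s t v] \<rho>(2,3) eq[OF N(2)]
    by simp
  ultimately show ?thesis by simp
qed

lemma frame_onD:
  assumes "frame_on N s"
  shows "b \<in> B \<Longrightarrow> s b \<in> sections A E T" "q \<in> N \<Longrightarrow> orthonormal q B (\<lambda>b. s b q)"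
  using assms by (auto simp: frame_on_def)

lemma frame_on_G:
  assumes "frame_on N s" "q \<in> N" "b \<in> B" "c \<in> B"
  shows "G q (s b q) (s c q) = (if b = c then 1 else 0)"
  using frame_onD(2)[OF assms(1,2)] assms(3,4) by (simp add: orthonormal_def)

text \<open>The expansion of \<open>t\<close> in the frame holds only on \<open>N\<close>, but its
  right-hand side is a global section, so locality and the Leibniz rule apply to it.\<close>

lemma nabla_in_frame:
  assumes s: "frame_on N s" and N: "open N" "p \<in> N" and v: "v \<in> tangent_space A p"
    and t: "t \<in> sections A E T"
  shows "nabla t p v = (\<Sum>c\<in>B. v (\<lambda>q. G q (t q) (s c q)) *\<^sub>R s c p + G p (t p) (s c p) *\<^sub>R nabla (s c) p v)"
proof -
  note sS = frame_onD(1)[OF s]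
  have g: "(\<lambda>q. G q (t q) (s c q)) \<in> smooth_funs A" if "c \<in> B" for c
    by (rule G_smooth[OF t sS[OF that]])
  have gs: "(\<lambda>q. G q (t q) (s c q) *\<^sub>R s c q) \<in> sections A E T" if "c \<in> B" for c
    by (rule section_scale[OF g[OF that] sS[OF that]])
  have "nabla t p v = nabla (\<lambda>q. \<Sum>c\<in>B. G q (t q) (s c q) *\<^sub>R s c q) p v"
    by (rule nabla_local[OF t section_sum v N], erule gs)
       (rule orthonormal_expand[OF frame_onD(2)[OF s] section_in_E[OF t]])
  also have "\<dots> = (\<Sum>c\<in>B. nabla (\<lambda>q. G q (t q) (s c q) *\<^sub>R s c q) p v)"
    by (rule nabla_sum[OF gs v])
  also have "\<dots> = (\<Sum>c\<in>B. v (\<lambda>q. G q (t q) (s c q)) *\<^sub>R s c p + G p (t p) (s c p) *\<^sub>R nabla (s c) p v)"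
    by (rule sum.cong[OF refl]) (rule nabla_scale[OF g sS v])
  finally show ?thesis .
qed

lemma G_nabla_in_frame:
  assumes s: "frame_on N s" and N: "open N" "p \<in> N" and v: "v \<in> tangent_space A p"
    and t: "t \<in> sections A E T" and y: "y \<in> E p"
  shows "G p (nabla t p v) y = (\<Sum>c\<in>B. v (\<lambda>q. G q (t q) (s c q)) * G p (s c p) y
    + G p (t p) (s c p) * G p (nabla (s c) p v) y)"
proof -
  note sS = frame_onD(1)[OF s]
  have E1: "v (\<lambda>q. G q (t q) (s c q)) *\<^sub>R s c p \<in> E p" if "c \<in> B" for c
    by (rule E_closed(2)[OF section_in_E[OF sS[OF that]]])
  have E2: "G p (t p) (s c p) *\<^sub>R nabla (s c) p v \<in> E p" if "c \<in> B" for c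
    by (rule E_closed(2)[OF nabla_in_E[OF sS[OF that] v]])
  have "G p (nabla t p v) y = (\<Sum>c\<in>B. G p (v (\<lambda>q. G q (t q) (s c q)) *\<^sub>R s c p
      + G p (t p) (s c p) *\<^sub>R nabla (s c) p v) y)"
    unfolding nabla_in_frame[OF s N v t] by (rule G_sum[OF E_closed(1)[OF E1 E2] y])
  also have "\<dots> = (\<Sum>c\<in>B. v (\<lambda>q. G q (t q) (s c q)) * G p (s c p) y
    + G p (t p) (s c p) * G p (nabla (s c) p v) y)"
  proof (rule sum.cong[OF refl])
    fix c assume c: "c \<in> B"
    show "G p (v (\<lambda>q. G q (t q) (s c q)) *\<^sub>R s c p + G p (t p) (s c p) *\<^sub>R nabla (s c) p v) y
      = v (\<lambda>q. G q (t q) (s c q)) * G p (s c p) y + G p (t p) (s c p) * G p (nabla (s c) p v) y"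
      unfolding G_add[OF E1[OF c] E2[OF c] y] G_scale[OF section_in_E[OF sS[OF c]] y]
        G_scale[OF nabla_in_E[OF sS[OF c] v] y] ..
  qed
  finally show ?thesis .
qed

text \<open>This is tr C(v) for the connection matrix \<open>C\<close> of \<open>s\<close>: in an
  orthonormal frame each summand is the coefficient of \<open>s b\<close> in the derivative of
  \<open>s b\<close>.\<close>

definition frame_trace :: "('f \<Rightarrow> 'm \<Rightarrow> 'v) \<Rightarrow> 'm \<Rightarrow> 'm tangent \<Rightarrow> real"
  where "frame_trace s p v = (\<Sum>b\<in>B. G p (nabla (s b) p v) (s b p))"

text \<open>Two orthonormal frames differ by an orthogonal matrix \<open>g\<close>, and \<open>tr (g\<^sup>T dg) = 0\<close>.\<close>

lemma frame_trace_unique: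
  assumes s: "frame_on N s" "open N" "p \<in> N" and t: "frame_on M t" "open M" "p \<in> M"
    and v: "v \<in> tangent_space A p"
  shows "frame_trace t p v = frame_trace s p v"
proof -
  note sS = frame_onD(1)[OF s(1)] and tS = frame_onD(1)[OF t(1)]
  define g where "g = (\<lambda>b c q. G q (t b q) (s c q))"
  have gsm: "g b c \<in> smooth_funs A" if "b \<in> B" "c \<in> B" for b c
    unfolding g_def by (rule G_smooth[OF tS[OF that(1)] sS[OF that(2)]])
  have gsym: "G p (s c p) (t b p) = g b c p" if "b \<in> B" "c \<in> B" for b c
    unfolding g_def by (rule G_sym[OF section_in_E[OF sS[OF that(2)]] section_in_E[OF tS[OF that(1)]]])
  have row: "(\<Sum>c\<in>B. g b c q * g b c q) = 1" if b: "b \<in> B" and q: "q \<in> N \<inter> M" for b q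
  proof -
    have qN: "q \<in> N" and qM: "q \<in> M" using q by auto
    have tE: "t b q \<in> E q" by (rule section_in_E[OF tS[OF b]])
    have "1 = G q (t b q) (t b q)" using frame_on_G[OF t(1) qM b b] by simp
    also have "\<dots> = G q (\<Sum>c\<in>B. g b c q *\<^sub>R s c q) (t b q)"
      unfolding g_def by (subst orthonormal_expand[OF frame_onD(2)[OF s(1) qN] tE, symmetric]) (rule refl)
    also have "\<dots> = (\<Sum>c\<in>B. g b c q * G q (s c q) (t b q))"
      by (rule G_lincomb[OF section_in_E[OF sS] tE])
    also have "\<dots> = (\<Sum>c\<in>B. g b c q * g b c q)"
      by (rule sum.cong[OF refl]) (simp add: g_def G_sym[OF section_in_E[OF sS] tE])
    finally show ?thesis by simp
  qed
  \<comment> \<open>Differentiating the row identity, valid near p, removes the inhomogeneous term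
    for each row separately.\<close>
  have dg: "(\<Sum>c\<in>B. v (g b c) * g b c p) = 0" if b: "b \<in> B" for b
  proof -
    have sm: "(\<lambda>q. g b c q * g b c q) \<in> smooth_funs A" if "c \<in> B" for c
      by (rule smooth_funs_mult[OF gsm[OF b that] gsm[OF b that]])
    have "v (\<lambda>q. \<Sum>c\<in>B. g b c q * g b c q) = v (\<lambda>q. 1)"
      by (rule tangent_local[OF v smooth_funs_sum[OF sm] smooth_funs_const open_Int[OF s(2) t(2)] _ row[OF b]])
         (use s(3) t(3) in auto)
    then have "0 = v (\<lambda>q. \<Sum>c\<in>B. g b c q * g b c q)" using tangent_const[OF v] by simp
    also have "\<dots> = (\<Sum>c\<in>B. v (\<lambda>q. g b c q * g b c q))"
      by (rule tangent_sum[OF v sm])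
    also have "\<dots> = (\<Sum>c\<in>B. 2 * (v (g b c) * g b c p))"
      by (rule sum.cong[OF refl]) (simp add: tangent_mult[OF v gsm[OF b] gsm[OF b]])
    also have "\<dots> = 2 * (\<Sum>c\<in>B. v (g b c) * g b c p)" by (rule sum_distrib_left[symmetric])
    finally show ?thesis by simp
  qed
  have "G p (nabla (t b) p v) (t b p) = (\<Sum>c\<in>B. g b c p * G p (nabla (s c) p v) (t b p))"
    if b: "b \<in> B" for b
  proof -
    have "G p (nabla (t b) p v) (t b p) = (\<Sum>c\<in>B. v (g b c) * G p (s c p) (t b p)
        + g b c p * G p (nabla (s c) p v) (t b p))"
      using G_nabla_in_frame[OF s v tS[OF b] section_in_E[OF tS[OF b]]] unfolding g_def .
    also have "\<dots> = (\<Sum>c\<in>B. v (g b c) * g b c p + g b c p * G p (nabla (s c) p v) (t b p))"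
      by (rule sum.cong[OF refl]) (simp add: gsym[OF b])
    finally show ?thesis using dg[OF b] by (simp add: sum.distrib)
  qed
  then have "frame_trace t p v = (\<Sum>b\<in>B. \<Sum>c\<in>B. g b c p * G p (nabla (s c) p v) (t b p))"
    unfolding frame_trace_def by (rule sum.cong[OF refl])
  \<comment> \<open>With the sum over \<open>b\<close> innermost, the expansion of
    \<open>s c\<close> in the frame \<open>t\<close> can be recognised.\<close>
  also have "\<dots> = (\<Sum>c\<in>B. \<Sum>b\<in>B. g b c p * G p (nabla (s c) p v) (t b p))"
    by (rule sum.swap)
  also have "\<dots> = (\<Sum>c\<in>B. G p (nabla (s c) p v) (s c p))"
  proof (rule sum.cong[OF refl])
    fix c assume c: "c \<in> B"
    have nE: "nabla (s c) p v \<in> E p" by (rule nabla_in_E[OF sS[OF c] v])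
    have sE: "s c p \<in> E p" by (rule section_in_E[OF sS[OF c]])
    have tE: "t b p \<in> E p" if "b \<in> B" for b by (rule section_in_E[OF tS[OF that]])
    have "G p (nabla (s c) p v) (s c p) = G p (s c p) (nabla (s c) p v)" by (rule G_sym[OF nE sE])
    also have "\<dots> = G p (\<Sum>b\<in>B. G p (s c p) (t b p) *\<^sub>R t b p) (nabla (s c) p v)"
      by (subst orthonormal_expand[OF frame_onD(2)[OF t(1,3)] sE, symmetric]) (rule refl)
    also have "\<dots> = (\<Sum>b\<in>B. G p (s c p) (t b p) * G p (t b p) (nabla (s c) p v))"
      by (rule G_lincomb[OF tE nE])
    also have "\<dots> = (\<Sum>b\<in>B. g b c p * G p (nabla (s c) p v) (t b p))"
      by (rule sum.cong[OF refl]) (simp add: gsym[OF _ c] G_sym[OF nE tE])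
    finally show "(\<Sum>b\<in>B. g b c p * G p (nabla (s c) p v) (t b p)) = G p (nabla (s c) p v) (s c p)" ..
  qed
  finally show ?thesis unfolding frame_trace_def .
qed

text \<open>The choice is made point by point and may jump. As the trace does not depend on the
  frame, regularity of \<open>trace_form\<close> can still be checked in one frame over a
  neighbourhood.\<close>

definition frame_at :: "'m \<Rightarrow> 'f \<Rightarrow> 'm \<Rightarrow> 'v"
  where "frame_at p = (SOME s. \<exists>N. open N \<and> p \<in> N \<and> frame_on N s)"

definition trace_form :: "'m \<Rightarrow> 'm tangent \<Rightarrow> real"
  where "trace_form p v = frame_trace (frame_at p) p v / card B"

lemma trace_form_eq:
  assumes s: "frame_on N s" "open N" "p \<in> N" and v: "v \<in> tangent_space A p"
  shows "trace_form p v = frame_trace s p v / card B"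
proof -
  have "\<exists>s N. open N \<and> p \<in> N \<and> frame_on N s" by (rule frame_exists)
  then have "\<exists>N. open N \<and> p \<in> N \<and> frame_on N (frame_at p)"
    unfolding frame_at_def by (rule someI_ex)
  then obtain M where M: "open M" "p \<in> M" "frame_on M (frame_at p)" by blast
  show ?thesis
    unfolding trace_form_def frame_trace_unique[OF s M(3,1,2) v] ..
qed

lemma frame_trace_smooth:
  assumes s: "frame_on N s" and X: "X \<in> vector_fields A"
  shows "(\<lambda>q. frame_trace s q (X q)) \<in> smooth_funs A"
  unfolding frame_trace_def
  by (rule smooth_funs_sum, rule G_smooth[OF nabla_section[OF frame_onD(1)[OF s] X] frame_onD(1)[OF s]])

lemma smooth_funs_divide: "f \<in> smooth_funs A \<Longrightarrow> (\<lambda>q. f q / c) \<in> smooth_funs A"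
  using smooth_funs_mult[OF smooth_funs_const[of "1 / c"], of f] by simp

lemma trace_form_smooth:
  assumes X: "X \<in> vector_fields A"
  shows "(\<lambda>q. trace_form q (X q)) \<in> smooth_funs A"
proof (rule smooth_funs_local)
  fix p
  obtain s N where N: "open N" "p \<in> N" and s: "frame_on N s" using frame_exists[of p] by metis
  have "\<forall>q\<in>N. trace_form q (X q) = frame_trace s q (X q) / card B"
    using trace_form_eq[OF s N(1) _ vector_field_tangent[OF X]] by simp
  with N smooth_funs_divide[OF frame_trace_smooth[OF s X]]
  show "\<exists>N h. open N \<and> p \<in> N \<and> (\<forall>q\<in>N. trace_form q (X q) = h q) \<and> h \<in> smooth_funs A"
    by (intro exI[of _ N] exI[of _ "\<lambda>q. frame_trace s q (X q) / card B"]) simp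
qed

lemma trace_form_linear: "linear_on_tangent A p (trace_form p)"
proof -
  define s where "s = frame_at p"
  have "\<exists>s N. open N \<and> p \<in> N \<and> frame_on N s" by (rule frame_exists)
  then have "\<exists>N. open N \<and> p \<in> N \<and> frame_on N s"
    unfolding s_def frame_at_def by (rule someI_ex)
  then obtain N where s: "frame_on N s" by blast
  note sS = frame_onD(1)[OF s]
  have "frame_trace s p (\<lambda>f. v f + w f) = frame_trace s p v + frame_trace s p w"
    if v: "v \<in> tangent_space A p" and w: "w \<in> tangent_space A p" for v w
    unfolding frame_trace_def sum.distrib[symmetric]
  proof (rule sum.cong[OF refl])
    fix b assume b: "b \<in> B"
    have "nabla (s b) p (\<lambda>f. v f + w f) = nabla (s b) p v + nabla (s b) p w"
      using nabla_linear[OF sS[OF b]] v w by (simp add: linear_on_tangent_def)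
    then show "G p (nabla (s b) p (\<lambda>f. v f + w f)) (s b p) =
        G p (nabla (s b) p v) (s b p) + G p (nabla (s b) p w) (s b p)"
      using G_add[OF nabla_in_E[OF sS[OF b] v] nabla_in_E[OF sS[OF b] w] section_in_E[OF sS[OF b]]] by simp
  qed
  moreover have "frame_trace s p (\<lambda>f. c * v f) = c * frame_trace s p v"
    if v: "v \<in> tangent_space A p" for c v
    unfolding frame_trace_def sum_distrib_left
  proof (rule sum.cong[OF refl])
    fix b assume b: "b \<in> B"
    have "nabla (s b) p (\<lambda>f. c * v f) = c *\<^sub>R nabla (s b) p v"
      using nabla_linear[OF sS[OF b]] v by (simp add: linear_on_tangent_def)
    then show "G p (nabla (s b) p (\<lambda>f. c * v f)) (s b p) = c * G p (nabla (s b) p v) (s b p)"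
      using G_scale[OF nabla_in_E[OF sS[OF b] v] section_in_E[OF sS[OF b]]] by simp
  qed
  ultimately show ?thesis
    unfolding linear_on_tangent_def trace_form_def s_def[symmetric] by (simp add: add_divide_distrib)
qed

lemma one_form_trace_form: "one_form A trace_form"
  unfolding one_form_def using trace_form_linear trace_form_smooth by blast

text \<open>In an orthonormal frame, \<open>\<nabla>\<^sup>2\<close> is \<open>dC + C \<and> C\<close>, and \<open>tr (C \<and> C) = 0\<close>.\<close>

lemma frame_trace_nabla_squared:
  assumes s: "frame_on N s" "open N" "p \<in> N"
    and X: "X \<in> vector_fields A" and Y: "Y \<in> vector_fields A"
  shows "(\<Sum>b\<in>B. G p (nabla_squared nabla (s b) X Y p) (s b p)) =
    X p (\<lambda>q. frame_trace s q (Y q)) - Y p (\<lambda>q. frame_trace s q (X q)) -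
    frame_trace s p (bracket X Y p)"
proof -
  note sS = frame_onD(1)[OF s(1)]
  have sE: "s b q \<in> E q" if "b \<in> B" for b q by (rule section_in_E[OF sS[OF that]])
  define C where "C = (\<lambda>Z b c q. G q (nabla (s b) q (Z q)) (s c q))"
  have second: "G p (nabla (\<lambda>q. nabla (s b) q (W q)) p (Z p)) (s b p) =
      Z p (C W b b) + (\<Sum>c\<in>B. C W b c p * C Z c b p)"
    if b: "b \<in> B" and Z: "Z \<in> vector_fields A" and W: "W \<in> vector_fields A" for b Z W
  proof -
    have "G p (nabla (\<lambda>q. nabla (s b) q (W q)) p (Z p)) (s b p) =
      (\<Sum>c\<in>B. Z p (C W b c) * G p (s c p) (s b p) + C W b c p * C Z c b p)"
      unfolding C_def
      by (rule G_nabla_in_frame[OF s vector_field_tangent[OF Z] nabla_section[OF sS[OF b] W] sE[OF b]])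
    also have "\<dots> = (\<Sum>c\<in>B. (if c = b then Z p (C W b b) else 0) + C W b c p * C Z c b p)"
      by (rule sum.cong[OF refl]) (simp add: frame_on_G[OF s(1,3) _ b])
    also have "\<dots> = Z p (C W b b) + (\<Sum>c\<in>B. C W b c p * C Z c b p)"
      using b finite_B by (simp add: sum.distrib)
    finally show ?thesis .
  qed
  have trace: "Z p (\<lambda>q. frame_trace s q (W q)) = (\<Sum>b\<in>B. Z p (C W b b))"
    if Z: "Z \<in> vector_fields A" and W: "W \<in> vector_fields A" for Z W
    unfolding frame_trace_def C_def
    by (rule tangent_sum[OF vector_field_tangent[OF Z] G_smooth[OF nabla_section[OF sS W] sS]])
  have entry: "G p (nabla_squared nabla (s b) X Y p) (s b p) =
      X p (C Y b b) + (\<Sum>c\<in>B. C Y b c p * C X c b p) -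
      (Y p (C X b b) + (\<Sum>c\<in>B. C X b c p * C Y c b p)) -
      G p (nabla (s b) p (bracket X Y p)) (s b p)" if b: "b \<in> B" for b
  proof -
    have 1: "nabla (\<lambda>q. nabla (s b) q (Y q)) p (X p) \<in> E p"
      by (rule nabla_in_E[OF nabla_section[OF sS[OF b] Y] vector_field_tangent[OF X]])
    have 2: "nabla (\<lambda>q. nabla (s b) q (X q)) p (Y p) \<in> E p"
      by (rule nabla_in_E[OF nabla_section[OF sS[OF b] X] vector_field_tangent[OF Y]])
    have 3: "nabla (s b) p (bracket X Y p) \<in> E p"
      by (rule nabla_in_E[OF sS[OF b] bracket_tangent[OF X Y]])
    show ?thesis
      unfolding nabla_squared_def ext_cov_deriv_def
        G_diff[OF E_closed(3)[OF 1 2] 3 sE[OF b]] G_diff[OF 1 2 sE[OF b]]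
        second[OF b X Y] second[OF b Y X] ..
  qed
  \<comment> \<open>This is tr (C(Y) C(X)) = tr (C(X) C(Y)), the reason why the quadratic terms
    cancel.\<close>
  have swap: "(\<Sum>b\<in>B. \<Sum>c\<in>B. C Y b c p * C X c b p) = (\<Sum>b\<in>B. \<Sum>c\<in>B. C X b c p * C Y c b p)"
    by (subst sum.swap) (simp add: mult.commute)
  have "(\<Sum>b\<in>B. G p (nabla_squared nabla (s b) X Y p) (s b p)) =
      (\<Sum>b\<in>B. X p (C Y b b) + (\<Sum>c\<in>B. C Y b c p * C X c b p) -
      (Y p (C X b b) + (\<Sum>c\<in>B. C X b c p * C Y c b p)) -
      G p (nabla (s b) p (bracket X Y p)) (s b p))"
    by (rule sum.cong[OF refl entry])
  then show ?thesis
    unfolding trace[OF X Y] trace[OF Y X]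
    by (simp add: sum.distrib sum_subtractf swap frame_trace_def)
qed

lemma curvature_eq_ext_deriv:
  assumes h: "is_curvature A E T nabla h" and B: "B \<noteq> {}"
    and X: "X \<in> vector_fields A" and Y: "Y \<in> vector_fields A"
  shows "h p (X p) (Y p) = ext_deriv trace_form X Y p"
proof -
  obtain s N where N: "open N" "p \<in> N" and s: "frame_on N s" using frame_exists[of p] by metis
  note sS = frame_onD(1)[OF s]
  have sE: "s b q \<in> E q" if "b \<in> B" for b q by (rule section_in_E[OF sS[OF that]])
  define n where "n = real (card B)"
  have n: "n \<noteq> 0" using B finite_B by (simp add: n_def)
  have "nabla_squared nabla (s b) X Y p = h p (X p) (Y p) *\<^sub>R s b p" if "b \<in> B" for b
    using h sS[OF that] X Y unfolding is_curvature_def by blast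
  then have "G p (nabla_squared nabla (s b) X Y p) (s b p) = h p (X p) (Y p)" if "b \<in> B" for b
    using that G_scale[OF sE[OF that] sE[OF that]] frame_on_G[OF s N(2) that that] by simp
  then have "n * h p (X p) (Y p) = (\<Sum>b\<in>B. G p (nabla_squared nabla (s b) X Y p) (s b p))"
    by (simp add: n_def)
  also have "\<dots> = X p (\<lambda>q. frame_trace s q (Y q)) - Y p (\<lambda>q. frame_trace s q (X q)) -
      frame_trace s p (bracket X Y p)"
    by (rule frame_trace_nabla_squared[OF s N X Y])
  also have "\<dots> = n * ext_deriv trace_form X Y p"
  proof -
    have "Z p (\<lambda>q. frame_trace s q (W q)) = n * Z p (\<lambda>q. trace_form q (W q))"
      if Z: "Z \<in> vector_fields A" and W: "W \<in> vector_fields A" for Z W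
    proof -
      \<comment> \<open>The two functions agree only on \<open>N\<close>; locality of the derivation
        \<open>Z p\<close> is enough.\<close>
      have "Z p (\<lambda>q. frame_trace s q (W q)) = Z p (\<lambda>q. n * trace_form q (W q))"
      proof (rule tangent_local[OF vector_field_tangent[OF Z] frame_trace_smooth[OF s W] _ N])
        show "(\<lambda>q. n * trace_form q (W q)) \<in> smooth_funs A"
          by (rule smooth_funs_mult[OF smooth_funs_const trace_form_smooth[OF W]])
        show "frame_trace s q (W q) = n * trace_form q (W q)" if "q \<in> N" for q
          using trace_form_eq[OF s N(1) that vector_field_tangent[OF W]] n by (simp add: n_def)
      qed
      then show ?thesis
        using tangent_cmult[OF vector_field_tangent[OF Z] trace_form_smooth[OF W]] by simp
    qed
    moreover have "frame_trace s p (bracket X Y p) = n * trace_form p (bracket X Y p)"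
      using trace_form_eq[OF s N bracket_tangent[OF X Y]] n by (simp add: n_def)
    ultimately show ?thesis
      using X Y by (simp add: ext_deriv_def algebra_simps)
  qed
  finally show ?thesis using n by simp
qed

section \<open>Subtracting a 1-form from a connection\<close>

lemma connection_conn_minus:
  assumes \<omega>: "one_form A \<omega>"
  shows "connection A E T (conn_minus nabla \<omega>)"
proof -
  have lin: "\<omega> p (\<lambda>f. v f + w f) = \<omega> p v + \<omega> p w" "\<omega> p (\<lambda>f. c * v f) = c * \<omega> p v"
    if "v \<in> tangent_space A p" "w \<in> tangent_space A p" for p v w c
    using \<omega> that by (auto simp: one_form_def linear_on_tangent_def)
  have "bundle_one_form A E T (conn_minus nabla \<omega> s)" if s: "s \<in> sections A E T" for s
  proof -
    have "linear_on_tangent A p (conn_minus nabla \<omega> s p)" for p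
      using nabla_linear[OF s, of p] lin[of _ p]
      by (simp add: linear_on_tangent_def conn_minus_def algebra_simps)
    moreover have "conn_minus nabla \<omega> s p v \<in> E p" if "v \<in> tangent_space A p" for p v
      unfolding conn_minus_def
      by (rule E_closed(3)[OF nabla_in_E[OF s that] E_closed(2)[OF section_in_E[OF s]]])
    moreover have "(\<lambda>p. conn_minus nabla \<omega> s p (X p)) \<in> sections A E T" if X: "X \<in> vector_fields A" for X
    proof -
      have "(\<lambda>p. \<omega> p (X p)) \<in> smooth_funs A" using \<omega> X by (simp add: one_form_def)
      from section_diff[OF nabla_section[OF s X] section_scale[OF this s]]
      show ?thesis unfolding conn_minus_def .
    qed
    ultimately show ?thesis unfolding bundle_one_form_def by blast
  qed
  moreover have "conn_minus nabla \<omega> (\<lambda>q. s q + t q) p v =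
      conn_minus nabla \<omega> s p v + conn_minus nabla \<omega> t p v"
    if "s \<in> sections A E T" "t \<in> sections A E T" "v \<in> tangent_space A p" for s t p v
    using nabla_add[OF that] by (simp add: conn_minus_def algebra_simps)
  moreover have "conn_minus nabla \<omega> (\<lambda>q. f q *\<^sub>R s q) p v =
      v f *\<^sub>R s p + f p *\<^sub>R conn_minus nabla \<omega> s p v"
    if "f \<in> smooth_funs A" "s \<in> sections A E T" "v \<in> tangent_space A p" for f s p v
    using nabla_scale[OF that] by (simp add: conn_minus_def algebra_simps)
  ultimately show ?thesis unfolding connection_def by blast
qed

text \<open>The cross terms \<omega>(X) \<nabla>_Y s + \<omega>(Y) \<nabla>_X s and the quadratic
  term \<omega>(X) \<omega>(Y) s are symmetric in \<open>X\<close> and \<open>Y\<close> and cancel.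
  What remains are derivatives of \<omega>(X) and \<omega>(Y) and the bracket term.\<close>

lemma nabla_squared_conn_minus:
  assumes \<omega>: "one_form A \<omega>" and s: "s \<in> sections A E T"
    and X: "X \<in> vector_fields A" and Y: "Y \<in> vector_fields A"
  shows "nabla_squared (conn_minus nabla \<omega>) s X Y p =
    nabla_squared nabla s X Y p - ext_deriv \<omega> X Y p *\<^sub>R s p"
proof -
  have first: "conn_minus nabla \<omega> (\<lambda>q. conn_minus nabla \<omega> s q (W q)) p (Z p) =
      nabla (\<lambda>q. nabla s q (W q)) p (Z p) - Z p (\<lambda>q. \<omega> q (W q)) *\<^sub>R s p
      - \<omega> p (W p) *\<^sub>R nabla s p (Z p) - \<omega> p (Z p) *\<^sub>R nabla s p (W p) + (\<omega> p (Z p) * \<omega> p (W p)) *\<^sub>R s p"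
    if Z: "Z \<in> vector_fields A" and W: "W \<in> vector_fields A" for Z W
  proof -
    have f: "(\<lambda>q. \<omega> q (W q)) \<in> smooth_funs A" using \<omega> W by (simp add: one_form_def)
    note Zp = vector_field_tangent[OF Z, of p]
    show ?thesis
      using nabla_diff[OF nabla_section[OF s W] section_scale[OF f s] Zp] nabla_scale[OF f s Zp]
      by (simp add: conn_minus_def algebra_simps)
  qed
  show ?thesis
    unfolding nabla_squared_def ext_cov_deriv_def first[OF X Y] first[OF Y X]
    by (simp add: conn_minus_def ext_deriv_def algebra_simps)
qed

end

theorem proposition6p3p1:
  fixes A :: "('m::{t2_space, second_countable_topology}, 'e::{real_inner, heine_borel}) chart set"
    and E :: "'m \<Rightarrow> 'v::real_vector set"
    and T :: "('m, 'v, 'f::{real_inner, heine_borel}) trivialization set"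
    and nabla :: "('m, 'v) conn"
  assumes "smooth_atlas A"
    and "connected (UNIV :: 'm set)"
    and "vector_bundle A E T"
    and "\<exists>p. E p \<noteq> {0}"
    and "connection A E T nabla"
    and "projectively_flat A E T nabla"
  shows "\<exists>\<omega>. one_form A \<omega> \<and>
    connection A E T (conn_minus nabla \<omega>) \<and>
    flat A E T (conn_minus nabla \<omega>) \<and>
    (\<forall>h. is_curvature A E T nabla h \<longrightarrow> is_ext_deriv A \<omega> h)"
proof -
  obtain B :: "'f set" where B: "finite B" "\<forall>b\<in>B. \<forall>c\<in>B. b \<bullet> c = (if b = c then 1 else 0)"
    "\<forall>x. x = (\<Sum>b\<in>B. (x \<bullet> b) *\<^sub>R b)"
    using finite_orthonormal_basis_exists by blast
  interpret smooth_vector_bundle A E T B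
  proof unfold_locales
    show "smooth_atlas A" "vector_bundle A E T" "finite B" by fact+
    show "b \<bullet> c = (if b = c then 1 else 0)" if "b \<in> B" "c \<in> B" for b c
      using B(2) that by blast
    show "x = (\<Sum>b\<in>B. (x \<bullet> b) *\<^sub>R b)" for x using B(3) by (rule spec)
  qed
  obtain G where G: "bundle_metric G" using bundle_metric_exists by metis
  interpret metric_bundle_connection A E T B G nabla
    by unfold_locales (fact G, fact assms(5))
  \<comment> \<open>An empty \<open>B\<close> means that the model fibre, common to all
    trivializations, is zero, and then so is every \<open>E p\<close>. This makes the division by
    \<open>card B\<close> legitimate.\<close>
  have "B \<noteq> {}"
  proof
    assume "B = {}"
    then have zero: "x = 0" for x :: 'f using B(3)[rule_format, of x] by simp
    obtain p where p: "E p \<noteq> {0}" using assms(4) by blast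
    obtain U \<tau> where U: "(U, \<tau>) \<in> T" "p \<in> U" by (rule trivialization_at)
    have "y = 0" if "y \<in> E p" for y
      using inv_triv_eq_0[OF U that zero] .
    with p E_closed(4)[of p] show False by blast
  qed
  \<comment> \<open>Kept general in \<open>h\<close>: flatness uses one curvature form, while the
    last claim is about all of them with the same \<omega>.\<close>
  then have dh: "h p (X p) (Y p) = ext_deriv trace_form X Y p"
    if "is_curvature A E T nabla h" "X \<in> vector_fields A" "Y \<in> vector_fields A" for h X Y p
    using curvature_eq_ext_deriv that by blast
  obtain h where h: "is_curvature A E T nabla h"
    using assms(6) unfolding projectively_flat_def by blast
  have "nabla_squared (conn_minus nabla trace_form) s X Y p = 0"
    if s: "s \<in> sections A E T" and X: "X \<in> vector_fields A" and Y: "Y \<in> vector_fields A" for s X Y p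
  proof -
    have "nabla_squared nabla s X Y p = h p (X p) (Y p) *\<^sub>R s p"
      using h s X Y unfolding is_curvature_def by blast
    then show ?thesis
      using nabla_squared_conn_minus[OF one_form_trace_form s X Y] dh[OF h X Y] by simp
  qed
  then have "flat A E T (conn_minus nabla trace_form)" unfolding flat_def by blast
  moreover have "is_ext_deriv A trace_form h" if "is_curvature A E T nabla h" for h
    unfolding is_ext_deriv_def using dh[OF that] by blast
  ultimately show ?thesis
    using one_form_trace_form connection_conn_minus[OF one_form_trace_form] by blast
qed

end
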